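(* Let $N\in\mathbb N$, $\alpha\in(0,N)$ and $p\in(1,\infty)$. Then $E^{\alpha,p}(\mathbb R^N)$ is uniformly convex.
   Context: $\mathbb N$ denotes the positive integers. For $\alpha\in(0,N)$ the Riesz potential is $I_\alpha(x)=A_\alpha|x|^{-(N-\alpha)}$ for $x\in\mathbb R^N\setminus\{0\}$, with $A_\alpha=\frac{\Gamma((N-\alpha)/2)}{\Gamma(\alpha/2)\pi^{N/2}2^\alpha}$. For $p\ge1$, the Coulomb--Sobolev space $E^{\alpha,p}(\mathbb R^N)$ is the vector space of (a.e. classes of) measurable functions $u:\mathbb R^N\to\mathbb R$ with $\int_{\mathbb R^N}|I_{\alpha/2}*|u|^p|^2<\infty$ that are weakly differentiable with $Du\in L^2(\mathbb R^N)$, normed by $$\|u\|_{E^{\alpha,p}}=\Bigl(\int_{\mathbb R^N}|Du|^2+\Bigl(\int_{\mathbb R^N}\bigl|I_{\alpha/2}*|u|^p\bigr|^2\Bigr)^{1/p}\Bigr)^{1/2}.$$ *)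

theory Defs
  imports "HOL-Analysis.Analysis"
begin

definition ae_equal :: "(real ^ 'n::finite \<Rightarrow> real) \<Rightarrow> (real ^ 'n \<Rightarrow> real) \<Rightarrow> bool" where
  "ae_equal u v \<longleftrightarrow>
     u \<in> borel_measurable lebesgue \<and> v \<in> borel_measurable lebesgue \<and> (AE x in lebesgue. u x = v x)"

quotient_type (overloaded) 'n ae_fun = "real ^ 'n::finite \<Rightarrow> real" / partial: ae_equal
proof (rule part_equivpI)
  show "\<exists>u :: real ^ 'n \<Rightarrow> real. ae_equal u u"
    by (intro exI[of _ "\<lambda>_. 0"]) (simp add: ae_equal_def)
  show "symp (ae_equal :: (real ^ 'n \<Rightarrow> real) \<Rightarrow> _)"
    by (auto simp: symp_def ae_equal_def elim: AE_mp)
  show "transp (ae_equal :: (real ^ 'n \<Rightarrow> real) \<Rightarrow> _)"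
  proof (rule transpI)
    fix u v w :: "real ^ 'n \<Rightarrow> real"
    assume uv: "ae_equal u v" and vw: "ae_equal v w"
    have "AE x in lebesgue. u x = w x"
      using uv vw unfolding ae_equal_def by (auto elim: AE_mp)
    with uv vw show "ae_equal u w" by (simp add: ae_equal_def)
  qed
qed

instantiation ae_fun :: (finite) real_vector
begin

lift_definition zero_ae_fun :: "'a ae_fun" is "\<lambda>_. 0"
  by (simp add: ae_equal_def)

lift_definition plus_ae_fun :: "'a ae_fun \<Rightarrow> 'a ae_fun \<Rightarrow> 'a ae_fun" is "\<lambda>u v x. u x + v x"
  unfolding ae_equal_def by (auto elim: AE_mp)

lift_definition minus_ae_fun :: "'a ae_fun \<Rightarrow> 'a ae_fun \<Rightarrow> 'a ae_fun" is "\<lambda>u v x. u x - v x"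
  unfolding ae_equal_def by (auto elim: AE_mp)

lift_definition uminus_ae_fun :: "'a ae_fun \<Rightarrow> 'a ae_fun" is "\<lambda>u x. - u x"
  unfolding ae_equal_def by (auto elim: AE_mp)

lift_definition scaleR_ae_fun :: "real \<Rightarrow> 'a ae_fun \<Rightarrow> 'a ae_fun" is "\<lambda>c u x. c * u x"
  unfolding ae_equal_def by (auto elim: AE_mp)

instance
  by standard (transfer; simp add: ae_equal_def algebra_simps)+

end

definition partial_deriv :: "'n::finite \<Rightarrow> (real ^ 'n \<Rightarrow> real) \<Rightarrow> real ^ 'n \<Rightarrow> real" where
  "partial_deriv i f x = frechet_derivative f (at x) (axis i 1)"

text \<open>A function is \<open>C\<^sup>\<infinity>\<close> iff all its iterated partial derivatives are differentiable;
  the empty list covers the function itself.\<close>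

definition smooth :: "(real ^ 'n::finite \<Rightarrow> real) \<Rightarrow> bool" where
  "smooth f \<longleftrightarrow> (\<forall>is. foldr partial_deriv is f differentiable_on UNIV)"

definition test_fun :: "(real ^ 'n::finite \<Rightarrow> real) \<Rightarrow> bool" where
  "test_fun \<phi> \<longleftrightarrow> smooth \<phi> \<and> compact (closure {x. \<phi> x \<noteq> 0})"

definition locally_integrable :: "(real ^ 'n::finite \<Rightarrow> 'b::{banach, second_countable_topology}) \<Rightarrow> bool"
  where "locally_integrable f \<longleftrightarrow> (\<forall>K. compact K \<longrightarrow> set_integrable lebesgue K f)"

lemma test_fun_measurable:
  assumes "test_fun \<phi>"
  shows "\<phi> \<in> borel_measurable lebesgue" and "partial_deriv i \<phi> \<in> borel_measurable lebesgue"
proof -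
  have *: "foldr partial_deriv is \<phi> \<in> borel_measurable lebesgue" for "is"
  proof -
    have "continuous_on UNIV (foldr partial_deriv is \<phi>)"
      using assms differentiable_imp_continuous_on by (auto simp: test_fun_def smooth_def)
    then show ?thesis
      by (intro measurable_completion) (simp add: borel_measurable_continuous_onI)
  qed
  show "\<phi> \<in> borel_measurable lebesgue" using *[of "[]"] by simp
  show "partial_deriv i \<phi> \<in> borel_measurable lebesgue" using *[of "[i]"] by simp
qed

lemma locally_integrable_cong:
  assumes "ae_equal u v"
  shows "locally_integrable u = locally_integrable v"
proof -
  have "set_integrable lebesgue K u = set_integrable lebesgue K v" if "compact K" for K
  proof -
    have [measurable]: "K \<in> sets lebesgue" "u \<in> borel_measurable lebesgue" "v \<in> borel_measurable lebesgue"
      using that assms by (auto simp: ae_equal_def lmeasurable_compact fmeasurableD)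
    have "AE x in lebesgue. indicator K x *\<^sub>R u x = indicator K x *\<^sub>R v x"
      using assms by (auto simp: ae_equal_def elim!: eventually_mono)
    then show ?thesis
      unfolding set_integrable_def by (intro integrable_cong_AE) measurable
  qed
  then show ?thesis by (simp add: locally_integrable_def)
qed

lift_definition has_weak_gradient :: "'n::finite ae_fun \<Rightarrow> (real ^ 'n \<Rightarrow> real ^ 'n) \<Rightarrow> bool" is
  "\<lambda>u g. locally_integrable u \<and> locally_integrable g \<and>
     (\<forall>\<phi> i. test_fun \<phi> \<longrightarrow>
        (LINT x|lebesgue. u x * partial_deriv i \<phi> x) = - (LINT x|lebesgue. g x $ i * \<phi> x))"
proof -
  fix u v :: "real ^ 'n \<Rightarrow> real"
  assume uv: "ae_equal u v"
  have "(LINT x|lebesgue. u x * partial_deriv i \<phi> x) = (LINT x|lebesgue. v x * partial_deriv i \<phi> x)"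
    if "test_fun \<phi>" for \<phi> i
  proof (rule integral_cong_AE)
    show "AE x in lebesgue. u x * partial_deriv i \<phi> x = v x * partial_deriv i \<phi> x"
      using uv by (auto simp: ae_equal_def elim!: eventually_mono)
    show "(\<lambda>x. u x * partial_deriv i \<phi> x) \<in> borel_measurable lebesgue"
      "(\<lambda>x. v x * partial_deriv i \<phi> x) \<in> borel_measurable lebesgue"
      using uv test_fun_measurable(2)[OF that]
      by (auto simp only: ae_equal_def intro!: borel_measurable_times)
  qed
  with locally_integrable_cong[OF uv] show "(\<lambda>g. locally_integrable u \<and> locally_integrable g \<and>
     (\<forall>\<phi> i. test_fun \<phi> \<longrightarrow>
        (LINT x|lebesgue. u x * partial_deriv i \<phi> x) = - (LINT x|lebesgue. g x $ i * \<phi> x))) =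
    (\<lambda>g. locally_integrable v \<and> locally_integrable g \<and>
     (\<forall>\<phi> i. test_fun \<phi> \<longrightarrow>
        (LINT x|lebesgue. v x * partial_deriv i \<phi> x) = - (LINT x|lebesgue. g x $ i * \<phi> x)))"
    by presburger
qed

definition weakly_differentiable :: "'n::finite ae_fun \<Rightarrow> bool" where
  "weakly_differentiable u \<longleftrightarrow> (\<exists>g. has_weak_gradient u g)"

text \<open>The weak gradient is determined up to null sets, so the choice of representative
  is immaterial for integrals.\<close>

definition weak_gradient :: "'n::finite ae_fun \<Rightarrow> real ^ 'n \<Rightarrow> real ^ 'n" where
  "weak_gradient u = (SOME g. has_weak_gradient u g)"

definition dirichlet_energy :: "'n::finite ae_fun \<Rightarrow> ennreal" where
  "dirichlet_energy u = (\<integral>\<^sup>+ x. ennreal ((norm (weak_gradient u x))\<^sup>2) \<partial>lebesgue)"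

definition riesz_const :: "nat \<Rightarrow> real \<Rightarrow> real" where
  "riesz_const N \<alpha> =
     Gamma ((real N - \<alpha>) / 2) / (Gamma (\<alpha> / 2) * pi powr (real N / 2) * 2 powr \<alpha>)"

text \<open>At the origin this takes the irrelevant value \<open>0\<close>.\<close>

definition riesz_kernel :: "real \<Rightarrow> real ^ 'n::finite \<Rightarrow> real" where
  "riesz_kernel \<alpha> x = riesz_const CARD('n) \<alpha> * norm x powr (- (real CARD('n) - \<alpha>))"

text \<open>Convolution of the Riesz kernel with a nonnegative function; the value may be infinite.\<close>

definition riesz_conv :: "real \<Rightarrow> (real ^ 'n::finite \<Rightarrow> real) \<Rightarrow> real ^ 'n \<Rightarrow> ennreal" where
  "riesz_conv \<alpha> f x = (\<integral>\<^sup>+ y. ennreal (riesz_kernel \<alpha> (x - y) * f y) \<partial>lebesgue)"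

lift_definition coulomb_energy :: "real \<Rightarrow> real \<Rightarrow> 'n::finite ae_fun \<Rightarrow> ennreal" is
  "\<lambda>\<alpha> p u. \<integral>\<^sup>+ x. (riesz_conv (\<alpha> / 2) (\<lambda>y. \<bar>u y\<bar> powr p) x)\<^sup>2 \<partial>lebesgue"
proof -
  fix \<alpha> p :: real and u v :: "real ^ 'n \<Rightarrow> real"
  assume uv: "ae_equal u v"
  have "riesz_conv (\<alpha> / 2) (\<lambda>y. \<bar>u y\<bar> powr p) x = riesz_conv (\<alpha> / 2) (\<lambda>y. \<bar>v y\<bar> powr p) x" for x
    unfolding riesz_conv_def
    by (rule nn_integral_cong_AE) (use uv in \<open>auto simp: ae_equal_def elim!: eventually_mono\<close>)
  then show "(\<integral>\<^sup>+ x. (riesz_conv (\<alpha> / 2) (\<lambda>y. \<bar>u y\<bar> powr p) x)\<^sup>2 \<partial>lebesgue) =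
      (\<integral>\<^sup>+ x. (riesz_conv (\<alpha> / 2) (\<lambda>y. \<bar>v y\<bar> powr p) x)\<^sup>2 \<partial>lebesgue)"
    by simp
qed

definition coulomb_sobolev :: "real \<Rightarrow> real \<Rightarrow> 'n::finite ae_fun set" where
  "coulomb_sobolev \<alpha> p =
     {u. coulomb_energy \<alpha> p u < \<infinity> \<and> weakly_differentiable u \<and> dirichlet_energy u < \<infinity>}"

definition coulomb_sobolev_norm :: "real \<Rightarrow> real \<Rightarrow> 'n::finite ae_fun \<Rightarrow> real" where
  "coulomb_sobolev_norm \<alpha> p u =
     sqrt (enn2real (dirichlet_energy u) + enn2real (coulomb_energy \<alpha> p u) powr (1 / p))"

text \<open>The norm is passed explicitly because the Coulomb--Sobolev space depends on real
  parameters, so that it is a set with a norm rather than an instance of a type class.\<close>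

definition uniformly_convex :: "'v::real_vector set \<Rightarrow> ('v \<Rightarrow> real) \<Rightarrow> bool" where
  "uniformly_convex V nrm \<longleftrightarrow>
     (\<forall>\<epsilon>>0. \<exists>\<delta>>0. \<forall>u\<in>V. \<forall>v\<in>V.
        nrm u = 1 \<longrightarrow> nrm v = 1 \<longrightarrow> nrm (u - v) \<ge> \<epsilon> \<longrightarrow> nrm ((1 / 2) *\<^sub>R (u + v)) \<le> 1 - \<delta>)"

end

theory Submission
  imports Defs
begin

text \<open>The square of the norm is \<open>A u + (q u)\<^sup>2\<close>, where \<open>A\<close> is the Dirichlet energy and
  \<open>q = B powr (1 / (2 * p))\<close> for the Coulomb energy \<open>B\<close>. The two parts are convex for different reasons,
  and an abstract lemma, \<open>uniformly_convex_sqrt_add\<close>, combines them.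

  The Dirichlet energy satisfies the parallelogram law (\<open>dirichlet_energy_parallelogram\<close>), because weak
  gradients add. As the energy is computed from a chosen weak gradient, this needs uniqueness of weak
  gradients, and hence the fundamental lemma of the calculus of variations
  (\<open>AE_eq_0_if_integral_test_fun_eq_0\<close>). For the latter it suffices to have test functions that
  approximate the indicators of boxes; products of the functions \<open>exp (-1/t)\<close> in the coordinates do so.

  The Coulomb energy is convex and homogeneous of degree \<open>2 * p\<close>, and for each \<open>\<eta> > 0\<close> there is some \<open>C\<close>
  with
  \<open>B (u - v) \<le> \<eta> * (B u + B v) + C * ((B u + B v) / 2 - B ((u + v) / 2))\<close>
  (\<open>coulomb_energy_uniformly_convex\<close>). The same inequality holds for \<open>\<bar>x\<bar> powr p\<close> on the real line by
  strict convexity, homogeneity and compactness (\<open>abs_powr_uniformly_convex\<close>). It is linear in the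
  \<open>p\<close>-th powers, so it passes through the convolution with the nonnegative Riesz kernel; it survives
  squaring, because \<open>0 \<le> m \<le> h\<close> implies \<open>(h - m)\<^sup>2 \<le> h\<^sup>2 - m\<^sup>2\<close>; and it can be integrated. Thus the Coulomb
  part is handled without a theory of mixed-norm Lebesgue spaces, for all \<open>p > 1\<close> at once.\<close>

section \<open>Smooth bump functions on boxes\<close>

text \<open>The bump functions below are built from the case \<open>k = 0\<close>. The powers of \<open>t\<close> are carried along because
  differentiation only raises \<open>k\<close>, so that the linear span of the family contains its derivatives.\<close>

definition flat :: "nat \<Rightarrow> real \<Rightarrow> real" where
  "flat k t = (if 0 < t then exp (- 1 / t) / t ^ k else 0)"

lemma flat_nonneg: "0 \<le> flat k t"
  by (simp add: flat_def)

lemma flat_0_le_1: "flat 0 t \<le> 1"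
  by (simp add: flat_def)

text \<open>The exponential beats every power: \<open>exp (1/t) \<ge> (1/(m t))^m\<close> with \<open>m = k + 2\<close>. The exponent
  is chosen so that a factor \<open>t\<^sup>2\<close> remains, which makes the derivative at the origin vanish.\<close>

lemma flat_le_square: "flat k t \<le> real (k + 2) ^ (k + 2) * t\<^sup>2"
proof (cases "0 < t")
  case True
  define m where "m = k + 2"
  have m: "0 < real m" by (simp add: m_def)
  have "(1 / (t * m)) ^ m \<le> (1 + (1 / t) / m) ^ m"
    using True m by (intro power_mono) (auto simp: field_simps)
  also have "\<dots> \<le> exp (1 / t)"
    using True by (intro exp_ge_one_plus_x_over_n_power_n) (auto simp: m_def intro: order_trans[of _ 0])
  finally have "1 \<le> exp (1 / t) * (t * m) ^ m"
    using True m by (simp add: power_divide divide_simps)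
  then have "exp (- 1 / t) \<le> (t * m) ^ m"
    by (simp add: exp_minus field_simps)
  also have "\<dots> = m ^ m * t\<^sup>2 * t ^ k"
    unfolding power_mult_distrib by (simp add: m_def power_add power2_eq_square algebra_simps)
  finally show ?thesis
    using True unfolding m_def[symmetric] by (simp add: flat_def pos_divide_le_eq)
qed (simp add: flat_def)

lemma has_real_derivative_flat:
  "(flat k has_real_derivative flat (k + 2) t - k * flat (k + 1) t) (at t)"
proof -
  consider "0 < t" | "t < 0" | "t = 0" by linarith
  then show ?thesis
  proof cases
    case 1
    have "((\<lambda>t. t ^ k) has_real_derivative k * t ^ k / t) (at t)"
      using 1 DERIV_pow[of k t] by (cases k) (auto simp del: DERIV_pow)
    moreover have "((\<lambda>t. exp (- 1 / t)) has_real_derivative exp (- 1 / t) / t\<^sup>2) (at t)"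
      using 1 by (auto intro!: derivative_eq_intros simp: power2_eq_square)
    ultimately have "((\<lambda>t. exp (- 1 / t) / t ^ k) has_real_derivative
        (exp (- 1 / t) / t\<^sup>2 * t ^ k - exp (- 1 / t) * (k * t ^ k / t)) / (t ^ k * t ^ k)) (at t)"
      using 1 by (intro DERIV_divide) auto
    also have "(exp (- 1 / t) / t\<^sup>2 * t ^ k - exp (- 1 / t) * (k * t ^ k / t)) / (t ^ k * t ^ k) =
        flat (k + 2) t - k * flat (k + 1) t"
      using 1 by (simp add: flat_def field_simps power2_eq_square)
    finally have "((\<lambda>t. exp (- 1 / t) / t ^ k) has_real_derivative
        flat (k + 2) t - k * flat (k + 1) t) (at t)" .
    moreover have "eventually (\<lambda>s. s \<in> {0<..}) (nhds t)"
      using 1 by (intro eventually_nhds_in_open) auto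
    ultimately show ?thesis
      by (subst DERIV_cong_ev[OF refl _ refl]) (auto simp: flat_def elim!: eventually_mono)
  next
    case 2
    have "((\<lambda>_. 0) has_real_derivative flat (k + 2) t - k * flat (k + 1) t) (at t)"
      using 2 by (simp add: flat_def)
    moreover have "eventually (\<lambda>s. s \<in> {..<0}) (nhds t)"
      using 2 by (intro eventually_nhds_in_open) auto
    ultimately show ?thesis
      by (subst DERIV_cong_ev[OF refl _ refl]) (auto simp: flat_def elim!: eventually_mono)
  next
    case 3
    define C where "C = real (k + 2) ^ (k + 2)"
    have "((\<lambda>h. (flat k (0 + h) - flat k 0) / h) \<longlongrightarrow> 0) (at 0)"
    proof (rule Lim_null_comparison)
      have "\<bar>flat k h / h\<bar> \<le> C * \<bar>h\<bar>" for h
        using flat_le_square[of k h] flat_nonneg[of k h]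
        by (cases "h = 0") (auto simp: C_def abs_div_pos divide_simps power2_eq_square abs_if mult_ac split: if_splits)
      then show "\<forall>\<^sub>F h in at 0. norm ((flat k (0 + h) - flat k 0) / h) \<le> C * \<bar>h\<bar>"
        by (simp add: flat_def)
      show "((\<lambda>h. C * \<bar>h\<bar>) \<longlongrightarrow> 0) (at 0)"
        by (auto intro!: tendsto_eq_intros)
    qed
    then show ?thesis using 3 by (simp add: DERIV_def flat_def)
  qed
qed

text \<open>Smoothness asks for all iterated partial derivatives at once. An algebra of differentiable
  functions that is closed under every partial derivative consists of smooth functions, and this one
  is generated by the functions above, applied to affine functions of single coordinates.\<close>

inductive_set flat_algebra :: "(real ^ 'n::finite \<Rightarrow> real) set" where
  const: "(\<lambda>_. c) \<in> flat_algebra"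
| flat: "(\<lambda>x. flat k (c * x $ i + d)) \<in> flat_algebra"
| add: "f \<in> flat_algebra \<Longrightarrow> g \<in> flat_algebra \<Longrightarrow> (\<lambda>x. f x + g x) \<in> flat_algebra"
| mult: "f \<in> flat_algebra \<Longrightarrow> g \<in> flat_algebra \<Longrightarrow> (\<lambda>x. f x * g x) \<in> flat_algebra"

lemma partial_deriv_eq:
  assumes "(f has_derivative f') (at x)"
  shows "partial_deriv i f x = f' (axis i 1)"
  using frechet_derivative_at[OF assms] by (simp add: partial_deriv_def)

lemma flat_algebra_differentiable:
  fixes f :: "real ^ 'n::finite \<Rightarrow> real"
  assumes "f \<in> flat_algebra"
  shows "f differentiable at x" and "partial_deriv i f \<in> flat_algebra"
proof -
  have "(\<forall>x. f differentiable at x) \<and> (\<forall>i. partial_deriv i f \<in> flat_algebra)"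
    using assms
  proof induction
    case (const c)
    have "partial_deriv i (\<lambda>_. c) = (\<lambda>_. 0)" for i :: 'n
      by (simp add: partial_deriv_def fun_eq_iff)
    then show ?case by (simp add: flat_algebra.const)
  next
    case (flat k c i d)
    let ?f = "\<lambda>x :: real ^ 'n. flat k (c * x $ i + d)"
    let ?f' = "\<lambda>x :: real ^ 'n. flat (k + 2) (c * x $ i + d) + (- real k) * flat (k + 1) (c * x $ i + d)"
    have D: "(?f has_derivative (\<lambda>h. (c * h $ i) * ?f' x)) (at x)" for x
    proof -
      have "((\<lambda>x. c * x $ i + d) has_derivative (\<lambda>h. c * h $ i)) (at x)"
        by (auto intro!: derivative_eq_intros bounded_linear.has_derivative[OF bounded_linear_vec_nth])
      from DERIV_compose_FDERIV[OF has_real_derivative_flat this]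
      show ?thesis by simp
    qed
    have "partial_deriv j ?f = (\<lambda>x. (if j = i then c else 0) * ?f' x)" for j
      by (rule ext) (subst partial_deriv_eq[OF D], simp add: axis_def)
    moreover have "(\<lambda>x. (if j = i then c else 0) * ?f' x) \<in> flat_algebra" for j
      by (intro flat_algebra.intros)
    ultimately show ?case using D by (auto simp: differentiable_def)
  next
    case (add f g)
    have "partial_deriv i (\<lambda>x. f x + g x) = (\<lambda>x. partial_deriv i f x + partial_deriv i g x)" for i
    proof
      fix x
      from add have "(f has_derivative frechet_derivative f (at x)) (at x)"
        "(g has_derivative frechet_derivative g (at x)) (at x)"
        by (simp_all add: frechet_derivative_works[symmetric])
      from partial_deriv_eq[OF has_derivative_add[OF this]]
      show "partial_deriv i (\<lambda>x. f x + g x) x = partial_deriv i f x + partial_deriv i g x"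
        by (simp add: partial_deriv_def)
    qed
    with add show ?case by (auto intro: flat_algebra.intros)
  next
    case (mult f g)
    have "partial_deriv i (\<lambda>x. f x * g x) = (\<lambda>x. f x * partial_deriv i g x + partial_deriv i f x * g x)" for i
    proof
      fix x
      from mult have "(f has_derivative frechet_derivative f (at x)) (at x)"
        "(g has_derivative frechet_derivative g (at x)) (at x)"
        by (simp_all add: frechet_derivative_works[symmetric])
      from partial_deriv_eq[OF has_derivative_mult[OF this]]
      show "partial_deriv i (\<lambda>x. f x * g x) x = f x * partial_deriv i g x + partial_deriv i f x * g x"
        by (simp add: partial_deriv_def)
    qed
    with mult show ?case by (auto intro!: flat_algebra.intros)
  qed
  then show "f differentiable at x" "partial_deriv i f \<in> flat_algebra" by auto
qed

lemma smooth_flat_algebra: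
  assumes "f \<in> flat_algebra"
  shows "smooth f"
proof -
  have "foldr partial_deriv is f \<in> flat_algebra" for "is"
    by (induction "is") (auto intro: assms flat_algebra_differentiable)
  then show ?thesis
    by (auto simp: smooth_def differentiable_on_def
        intro!: differentiable_at_withinI flat_algebra_differentiable)
qed

lemma flat_algebra_prod:
  assumes "finite I" "\<And>i. i \<in> I \<Longrightarrow> f i \<in> flat_algebra"
  shows "(\<lambda>x. \<Prod>i\<in>I. f i x) \<in> flat_algebra"
  using assms by (induction I rule: finite_induct) (auto intro: flat_algebra.intros)

text \<open>The scaling by \<open>n\<close> turns \<open>exp (-1/t)\<close> into \<open>exp (-1/(n t))\<close>, which tends to \<open>1\<close> for each
  \<open>t > 0\<close>. So these functions approximate the indicator of the box without any normalised cutoff.\<close>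

definition box_bump :: "real ^ 'n::finite \<Rightarrow> real ^ 'n \<Rightarrow> nat \<Rightarrow> real ^ 'n \<Rightarrow> real" where
  "box_bump a b n x = (\<Prod>i\<in>UNIV. flat 0 (n * (x $ i - a $ i)) * flat 0 (n * (b $ i - x $ i)))"

lemma box_bump_eq_0:
  assumes "x \<notin> box a b"
  shows "box_bump a b n x = 0"
proof -
  obtain i where "\<not> a $ i < x $ i \<or> \<not> x $ i < b $ i"
    using assms by (auto simp: mem_box_cart)
  then have "flat 0 (n * (x $ i - a $ i)) * flat 0 (n * (b $ i - x $ i)) = 0"
    by (auto simp: flat_def zero_less_mult_iff)
  then show ?thesis by (auto simp: box_bump_def)
qed

lemma box_bump_bounds: "0 \<le> box_bump a b n x" "box_bump a b n x \<le> 1"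
  unfolding box_bump_def
  by (auto intro!: prod_nonneg prod_le_1 mult_nonneg_nonneg mult_le_one flat_nonneg flat_0_le_1)

lemma box_bump_tendsto:
  "(\<lambda>n. box_bump a b n x) \<longlonglongrightarrow> indicator (box a b) x"
proof (cases "x \<in> box a b")
  case True
  have *: "(\<lambda>n. flat 0 (real n * t)) \<longlonglongrightarrow> 1" if "0 < t" for t
  proof -
    have "(\<lambda>n. exp (- (inverse (real n) * (1 / t)))) \<longlonglongrightarrow> exp (- (0 * (1 / t)))"
      by (intro tendsto_intros lim_inverse_n)
    moreover have "eventually (\<lambda>n. exp (- (inverse (real n) * (1 / t))) = flat 0 (real n * t)) sequentially"
      using eventually_gt_at_top[of 0] by eventually_elim (use that in \<open>auto simp: flat_def field_simps\<close>)
    ultimately show ?thesis by (simp add: tendsto_cong)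
  qed
  have "(\<lambda>n. box_bump a b n x) \<longlonglongrightarrow> (\<Prod>i\<in>(UNIV :: 'a set). 1 * 1)"
    unfolding box_bump_def using True by (intro tendsto_intros *) (auto simp: mem_box_cart)
  then show ?thesis using True by simp
qed (simp add: box_bump_eq_0)

lemma test_fun_box_bump: "test_fun (box_bump a b n)"
  unfolding test_fun_def
proof
  have 1: "(\<lambda>x. flat 0 (n * (x $ i - a $ i))) \<in> flat_algebra" for i
    using flat_algebra.flat[of 0 "real n" i "- real n * a $ i"] by (simp add: algebra_simps)
  have 2: "(\<lambda>x. flat 0 (n * (b $ i - x $ i))) \<in> flat_algebra" for i
    using flat_algebra.flat[of 0 "- real n" i "real n * b $ i"] by (simp add: algebra_simps)
  have "box_bump a b n \<in> flat_algebra"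
    unfolding box_bump_def[abs_def] by (intro flat_algebra_prod flat_algebra.mult 1 2) simp
  then show "smooth (box_bump a b n)" by (rule smooth_flat_algebra)
  have "{x. box_bump a b n x \<noteq> 0} \<subseteq> cbox a b"
    using box_bump_eq_0 box_subset_cbox by blast
  then have "bounded {x. box_bump a b n x \<noteq> 0}"
    using bounded_cbox bounded_subset by blast
  then show "compact (closure {x. box_bump a b n x \<noteq> 0})"
    by (simp add: compact_closure)
qed

section \<open>Uniqueness of weak gradients and the Dirichlet energy\<close>

text \<open>Lebesgue differentiation along cubes recovers \<open>f\<close> almost everywhere from its integrals over
  boxes.\<close>

lemma AE_eq_0_if_integral_cbox_eq_0:
  fixes f :: "real ^ 'n::finite \<Rightarrow> real"
  assumes f: "\<And>a b. f integrable_on cbox a b" and 0: "\<And>a b. integral (cbox a b) f = 0"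
  shows "AE x in lebesgue. f x = 0"
proof -
  from integrable_ccontinuous_explicit[of f, OF f] obtain N where N: "negligible N"
    and lim: "\<And>x e. x \<notin> N \<Longrightarrow> 0 < e \<Longrightarrow> \<exists>d>0. \<forall>h. 0 < h \<and> h < d \<longrightarrow>
      norm (integral (cbox x (x + h *\<^sub>R One)) f /\<^sub>R h ^ DIM(real ^ 'n) - f x) < e" by blast
  have "f x = 0" if "x \<notin> N" for x
  proof (rule ccontr)
    assume "f x \<noteq> 0"
    with lim[OF that, of "\<bar>f x\<bar>"] obtain d where "0 < d" and
      d: "\<forall>h. 0 < h \<and> h < d \<longrightarrow>
        norm (integral (cbox x (x + h *\<^sub>R One)) f /\<^sub>R h ^ DIM(real ^ 'n) - f x) < \<bar>f x\<bar>"
      by auto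
    from d[rule_format, of "d / 2"] \<open>0 < d\<close> show False by (simp add: 0)
  qed
  then show ?thesis
    using N by (intro AE_I'[of N]) (auto simp: negligible_iff_null_sets)
qed

lemma locally_integrable_measurable:
  fixes f :: "real ^ 'n::finite \<Rightarrow> 'b::{banach, second_countable_topology}"
  assumes "locally_integrable f"
  shows "f \<in> borel_measurable lebesgue"
proof (rule borel_measurable_LIMSEQ_metric)
  show "(\<lambda>x. indicator (cball 0 (real n)) x *\<^sub>R f x) \<in> borel_measurable lebesgue" for n
    using assms by (intro borel_measurable_integrable) (auto simp: locally_integrable_def set_integrable_def)
  show "(\<lambda>n. indicator (cball 0 (real n)) x *\<^sub>R f x) \<longlonglongrightarrow> f x" for x
  proof (rule tendsto_eventually)
    obtain m :: nat where "norm x \<le> m" using real_arch_simple by blast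
    then show "\<forall>\<^sub>F n in sequentially. indicator (cball 0 (real n)) x *\<^sub>R f x = f x"
      by (intro eventually_sequentiallyI[of m]) (auto simp: indicator_def)
  qed
qed

lemma locally_integrable_add:
  assumes "locally_integrable f" "locally_integrable g"
  shows "locally_integrable (\<lambda>x. f x + g x)"
  using assms by (auto simp: locally_integrable_def intro: set_integral_add)

lemma locally_integrable_minus:
  assumes "locally_integrable f"
  shows "locally_integrable (\<lambda>x. - f x)"
  using assms by (auto simp: locally_integrable_def set_integrable_def)

lemma locally_integrable_scaleR:
  assumes "locally_integrable f"
  shows "locally_integrable (\<lambda>x. c *\<^sub>R f x)"
  unfolding locally_integrable_def
proof (intro allI impI)
  fix K :: "(real ^ 'a) set"
  assume "compact K"
  with assms have "set_integrable lebesgue K f" by (simp add: locally_integrable_def)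
  then show "set_integrable lebesgue K (\<lambda>x. c *\<^sub>R f x)"
    by (rule set_integrable_scaleR_right)
qed

lemma locally_integrable_vec_nth:
  fixes g :: "real ^ 'n::finite \<Rightarrow> real ^ 'n"
  assumes "locally_integrable g"
  shows "locally_integrable (\<lambda>x. g x $ i)"
  unfolding locally_integrable_def set_integrable_def
proof (intro allI impI)
  fix K :: "(real ^ 'n) set"
  assume "compact K"
  with assms have "integrable lebesgue (\<lambda>x. indicator K x *\<^sub>R g x)"
    by (auto simp: locally_integrable_def set_integrable_def)
  from integrable_bounded_linear[OF bounded_linear_vec_nth this]
  show "integrable lebesgue (\<lambda>x. indicator K x *\<^sub>R g x $ i)" by simp
qed

lemma test_fun_partial_deriv:
  assumes "test_fun \<phi>"
  shows "test_fun (partial_deriv i \<phi>)"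
proof -
  define S where "S = closure {x. \<phi> x \<noteq> 0}"
  have "partial_deriv i \<phi> x = 0" if "x \<notin> S" for x
  proof -
    have "open (- S)" by (simp add: S_def open_Compl)
    have "(\<phi> has_derivative (\<lambda>_. 0)) (at x)"
    proof (rule has_derivative_transform_within_open[OF _ \<open>open (- S)\<close>])
      show "((\<lambda>_. 0) has_derivative (\<lambda>_. 0)) (at x)" by simp
      show "0 = \<phi> y" if "y \<in> - S" for y
        using that closure_subset[of "{x. \<phi> x \<noteq> 0}"] by (auto simp: S_def)
    qed (use that in auto)
    then show ?thesis by (simp add: partial_deriv_eq)
  qed
  then have "closure {x. partial_deriv i \<phi> x \<noteq> 0} \<subseteq> S"
    by (intro closure_minimal) (auto simp: S_def)
  moreover have "compact S" using assms by (simp add: S_def test_fun_def)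
  ultimately have "compact (closure {x. partial_deriv i \<phi> x \<noteq> 0})"
    using compact_Int_closed[of S] by (metis closed_closure inf.absorb_iff2)
  moreover have "smooth (partial_deriv i \<phi>)"
    unfolding smooth_def
  proof
    fix "is"
    show "foldr partial_deriv is (partial_deriv i \<phi>) differentiable_on UNIV"
      using assms[unfolded test_fun_def smooth_def, THEN conjunct1, rule_format, of "is @ [i]"] by simp
  qed
  ultimately show ?thesis by (simp add: test_fun_def)
qed

lemma integrable_mult_test_fun:
  fixes f :: "real ^ 'n::finite \<Rightarrow> real"
  assumes f: "locally_integrable f" and \<phi>: "test_fun \<phi>"
  shows "integrable lebesgue (\<lambda>x. f x * \<phi> x)"
proof -
  define K where "K = closure {x. \<phi> x \<noteq> 0}"
  have K: "compact K" using \<phi> by (simp add: K_def test_fun_def)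
  have supp: "\<phi> x = 0" if "x \<notin> K" for x
    using that closure_subset[of "{x. \<phi> x \<noteq> 0}"] by (auto simp: K_def)
  have "\<phi> differentiable_on UNIV"
    using \<phi>[unfolded test_fun_def smooth_def, THEN conjunct1, rule_format, of "[]"] by simp
  then have "continuous_on K \<phi>"
    using differentiable_imp_continuous_on continuous_on_subset by blast
  from compact_imp_bounded[OF compact_continuous_image[OF this K]]
  obtain C where C: "\<And>x. x \<in> K \<Longrightarrow> \<bar>\<phi> x\<bar> \<le> C" by (auto simp: bounded_iff)
  have "integrable lebesgue (\<lambda>x. C * (indicator K x *\<^sub>R f x))"
    using f K by (intro integrable_mult_right) (auto simp: locally_integrable_def set_integrable_def)
  then show ?thesis
  proof (rule Bochner_Integration.integrable_bound)
    show "(\<lambda>x. f x * \<phi> x) \<in> borel_measurable lebesgue"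
      using locally_integrable_measurable[OF f] test_fun_measurable(1)[OF \<phi>]
      by (rule borel_measurable_times)
    show "AE x in lebesgue. norm (f x * \<phi> x) \<le> norm (C * (indicator K x *\<^sub>R f x))"
    proof (rule AE_I2)
      fix x
      show "norm (f x * \<phi> x) \<le> norm (C * (indicator K x *\<^sub>R f x))"
      proof (cases "x \<in> K")
        case True
        then have "\<bar>f x\<bar> * \<bar>\<phi> x\<bar> \<le> \<bar>f x\<bar> * \<bar>C\<bar>"
          using C[OF True] by (intro mult_left_mono) auto
        then show ?thesis using True by (simp add: abs_mult mult.commute)
      qed (simp add: supp)
    qed
  qed
qed

text \<open>The fundamental lemma of the calculus of variations. Dominated convergence along the bump
  functions of a box gives that \<open>f\<close> integrates to zero over every box.\<close>

lemma AE_eq_0_if_integral_test_fun_eq_0: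
  fixes f :: "real ^ 'n::finite \<Rightarrow> real"
  assumes f: "locally_integrable f"
    and 0: "\<And>\<phi>. test_fun \<phi> \<Longrightarrow> (LINT x|lebesgue. f x * \<phi> x) = 0"
  shows "AE x in lebesgue. f x = 0"
proof (rule AE_eq_0_if_integral_cbox_eq_0)
  have si: "set_integrable lebesgue (cbox a b) f" for a b
    using f by (auto simp: locally_integrable_def)
  then show "f integrable_on cbox a b" for a b
    by (rule set_lebesgue_integral_eq_integral(1))
  show "integral (cbox a b) f = 0" for a b
  proof -
    have "(\<lambda>n. LINT x|lebesgue. f x * box_bump a b n x) \<longlonglongrightarrow> (LINT x|lebesgue. indicator (box a b) x *\<^sub>R f x)"
    proof (rule integral_dominated_convergence[where w = "\<lambda>x. norm (indicator (cbox a b) x *\<^sub>R f x)"])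
      show "(\<lambda>x. indicator (box a b) x *\<^sub>R f x) \<in> borel_measurable lebesgue"
        using locally_integrable_measurable[OF f] by (intro borel_measurable_scaleR borel_measurable_indicator) auto
      show "(\<lambda>x. f x * box_bump a b n x) \<in> borel_measurable lebesgue" for n
        using locally_integrable_measurable[OF f] test_fun_measurable(1)[OF test_fun_box_bump]
        by (rule borel_measurable_times)
      show "integrable lebesgue (\<lambda>x. norm (indicator (cbox a b) x *\<^sub>R f x))"
        using si[of a b] by (intro integrable_norm) (simp add: set_integrable_def)
      show "AE x in lebesgue. (\<lambda>n. f x * box_bump a b n x) \<longlonglongrightarrow> indicator (box a b) x *\<^sub>R f x"
      proof (rule AE_I2)
        fix x
        have "(\<lambda>n. f x * box_bump a b n x) \<longlonglongrightarrow> f x * indicator (box a b) x"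
          by (intro tendsto_intros box_bump_tendsto)
        then show "(\<lambda>n. f x * box_bump a b n x) \<longlonglongrightarrow> indicator (box a b) x *\<^sub>R f x"
          by (simp add: mult.commute)
      qed
      show "AE x in lebesgue. norm (f x * box_bump a b n x) \<le> norm (indicator (cbox a b) x *\<^sub>R f x)" for n
      proof (rule AE_I2)
        fix x
        show "norm (f x * box_bump a b n x) \<le> norm (indicator (cbox a b) x *\<^sub>R f x)"
        proof (cases "x \<in> box a b")
          case True
          then have "x \<in> cbox a b" using box_subset_cbox by blast
          moreover have "\<bar>f x\<bar> * \<bar>box_bump a b n x\<bar> \<le> \<bar>f x\<bar> * 1"
            using box_bump_bounds[of a b n x] by (intro mult_left_mono) auto
          ultimately show ?thesis by (simp add: abs_mult)
        qed (simp add: box_bump_eq_0)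
      qed
    qed
    then have "(LINT x|lebesgue. indicator (box a b) x *\<^sub>R f x) = 0"
      using LIMSEQ_unique by (auto simp: 0 test_fun_box_bump)
    moreover have "set_integrable lebesgue (box a b) f"
      using si[of a b] by (rule set_integrable_subset) (auto simp: box_subset_cbox)
    ultimately have "integral (box a b) f = 0"
      using set_lebesgue_integral_eq_integral(2) by (fastforce simp: set_lebesgue_integral_def)
    then show ?thesis by (simp add: integral_open_interval)
  qed
qed

lemma has_weak_gradient_locally_integrable:
  "has_weak_gradient u g \<Longrightarrow> locally_integrable g"
  by transfer blast

lemma has_weak_gradient_unique:
  assumes "has_weak_gradient u g" "has_weak_gradient u h"
  shows "AE x in lebesgue. g x = h x"
proof -
  have loc: "locally_integrable g" "locally_integrable h"
    using assms has_weak_gradient_locally_integrable by blast+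
  have eq: "(LINT x|lebesgue. g x $ i * \<phi> x) = (LINT x|lebesgue. h x $ i * \<phi> x)" if "test_fun \<phi>" for i \<phi>
    using assms that by transfer force
  have "AE x in lebesgue. g x $ i - h x $ i = 0" for i
  proof (rule AE_eq_0_if_integral_test_fun_eq_0)
    show "locally_integrable (\<lambda>x. g x $ i - h x $ i)"
      using locally_integrable_add[OF locally_integrable_vec_nth[OF loc(1)]
          locally_integrable_minus[OF locally_integrable_vec_nth[OF loc(2)]]] by simp
    fix \<phi> :: "real ^ 'a \<Rightarrow> real"
    assume \<phi>: "test_fun \<phi>"
    then show "(LINT x|lebesgue. (g x $ i - h x $ i) * \<phi> x) = 0"
      using eq[OF \<phi>] by (simp add: left_diff_distrib integrable_mult_test_fun locally_integrable_vec_nth loc)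
  qed
  then have "AE x in lebesgue. \<forall>i. g x $ i - h x $ i = 0"
    by (simp add: AE_all_countable)
  then show ?thesis by (auto simp: vec_eq_iff elim: eventually_mono)
qed

lemma has_weak_gradient_add:
  assumes "has_weak_gradient u g" "has_weak_gradient v h"
  shows "has_weak_gradient (u + v) (\<lambda>x. g x + h x)"
  using assms
  by transfer (simp add: locally_integrable_add distrib_right integrable_mult_test_fun
      test_fun_partial_deriv locally_integrable_vec_nth)

lemma has_weak_gradient_minus:
  assumes "has_weak_gradient u g"
  shows "has_weak_gradient (- u) (\<lambda>x. - g x)"
  using assms by transfer (simp add: locally_integrable_minus)

lemma has_weak_gradient_scaleR:
  assumes "has_weak_gradient u g"
  shows "has_weak_gradient (c *\<^sub>R u) (\<lambda>x. c *\<^sub>R g x)"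
  using assms by transfer (simp add: locally_integrable_scaleR locally_integrable_scaleR[where 'b = real, simplified] mult.assoc)

lemma has_weak_gradient_weak_gradient:
  "weakly_differentiable u \<Longrightarrow> has_weak_gradient u (weak_gradient u)"
  unfolding weak_gradient_def weakly_differentiable_def by (metis someI_ex)

text \<open>The Dirichlet energy refers to an arbitrarily chosen weak gradient; by uniqueness, any weak
  gradient can be used to compute it.\<close>

lemma dirichlet_energy_eq:
  assumes "has_weak_gradient u g"
  shows "dirichlet_energy u = (\<integral>\<^sup>+ x. ennreal ((norm (g x))\<^sup>2) \<partial>lebesgue)"
proof -
  have "has_weak_gradient u (weak_gradient u)"
    using assms has_weak_gradient_weak_gradient weakly_differentiable_def by blast
  from has_weak_gradient_unique[OF this assms] show ?thesis
    unfolding dirichlet_energy_def by (intro nn_integral_cong_AE) (auto elim: eventually_mono)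
qed

lemma weakly_differentiable_add:
  assumes "weakly_differentiable u" "weakly_differentiable v"
  shows "weakly_differentiable (u + v)"
  unfolding weakly_differentiable_def
  by (rule exI, rule has_weak_gradient_add[OF assms[THEN has_weak_gradient_weak_gradient]])

lemma weakly_differentiable_scaleR:
  assumes "weakly_differentiable u"
  shows "weakly_differentiable (c *\<^sub>R u)"
  unfolding weakly_differentiable_def
  by (rule exI, rule has_weak_gradient_scaleR[OF assms[THEN has_weak_gradient_weak_gradient]])

text \<open>The weak gradient of \<open>u \<plusminus> v\<close> is \<open>g \<plusminus> h\<close>, so the parallelogram law of the Euclidean norm
  integrates to one for the energy. In extended reals it also shows that \<open>u + v\<close> has finite energy
  when \<open>u\<close> and \<open>v\<close> do.\<close>

lemma dirichlet_energy_parallelogram: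
  assumes "weakly_differentiable u" "weakly_differentiable v"
  shows "dirichlet_energy (u + v) + dirichlet_energy (u - v) = 2 * dirichlet_energy u + 2 * dirichlet_energy v"
proof -
  define g h where "g = weak_gradient u" and "h = weak_gradient v"
  have g: "has_weak_gradient u g" and h: "has_weak_gradient v h"
    using assms by (simp_all add: g_def h_def has_weak_gradient_weak_gradient)
  have [measurable]: "g \<in> borel_measurable lebesgue" "h \<in> borel_measurable lebesgue"
    using g h has_weak_gradient_locally_integrable locally_integrable_measurable by blast+
  have eq: "ennreal ((norm (x + y))\<^sup>2) + ennreal ((norm (x - y))\<^sup>2)
      = 2 * ennreal ((norm x)\<^sup>2) + 2 * ennreal ((norm y)\<^sup>2)" for x y :: "real ^ 'a"
  proof -
    have "(norm (x + y))\<^sup>2 + (norm (x - y))\<^sup>2 = 2 * (norm x)\<^sup>2 + 2 * (norm y)\<^sup>2"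
      by (simp add: power2_norm_eq_inner inner_simps inner_commute)
    then have "ennreal ((norm (x + y))\<^sup>2 + (norm (x - y))\<^sup>2) = ennreal (2 * (norm x)\<^sup>2 + 2 * (norm y)\<^sup>2)"
      by simp
    then show ?thesis by (simp add: ennreal_mult'')
  qed
  have gh: "has_weak_gradient (u - v) (\<lambda>x. g x - h x)"
    using has_weak_gradient_add[OF g has_weak_gradient_minus[OF h]] by simp
  have "dirichlet_energy (u + v) + dirichlet_energy (u - v) =
      (\<integral>\<^sup>+ x. ennreal ((norm (g x + h x))\<^sup>2) + ennreal ((norm (g x - h x))\<^sup>2) \<partial>lebesgue)"
    by (simp add: dirichlet_energy_eq[OF has_weak_gradient_add[OF g h]] dirichlet_energy_eq[OF gh]
        nn_integral_add)
  also have "\<dots> = (\<integral>\<^sup>+ x. 2 * ennreal ((norm (g x))\<^sup>2) + 2 * ennreal ((norm (h x))\<^sup>2) \<partial>lebesgue)"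
    by (simp only: eq)
  also have "\<dots> = 2 * dirichlet_energy u + 2 * dirichlet_energy v"
    by (simp add: dirichlet_energy_eq[OF g] dirichlet_energy_eq[OF h] nn_integral_add nn_integral_cmult)
  finally show ?thesis .
qed

lemma weakly_differentiable_0: "weakly_differentiable (0 :: 'n::finite ae_fun)"
proof -
  have "has_weak_gradient (0 :: 'n ae_fun) (\<lambda>_. 0)"
    by transfer (simp add: locally_integrable_def set_integrable_def)
  then show ?thesis unfolding weakly_differentiable_def by (rule exI[of "has_weak_gradient 0"])
qed

lemma dirichlet_energy_scaleR:
  assumes "weakly_differentiable u"
  shows "dirichlet_energy (c *\<^sub>R u) = ennreal (c\<^sup>2) * dirichlet_energy u"
proof -
  note g = has_weak_gradient_weak_gradient[OF assms]
  have "weak_gradient u \<in> borel_measurable lebesgue"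
    using g has_weak_gradient_locally_integrable locally_integrable_measurable by blast
  then show ?thesis
    unfolding dirichlet_energy_eq[OF has_weak_gradient_scaleR[OF g]] dirichlet_energy_eq[OF g]
    by (simp add: power_mult_distrib ennreal_mult nn_integral_cmult)
qed

section \<open>Uniform convexity of the Coulomb energy\<close>

text \<open>The triangle inequality reduces to nonnegative arguments. For two positive ones this is convexity
  of the power function; if one of them vanishes, it follows from
  \<open>t powr p \<le> t\<close>.\<close>

lemma abs_powr_convex:
  fixes a b :: real
  assumes "1 \<le> p" "0 \<le> t" "t \<le> 1"
  shows "\<bar>t * a + (1 - t) * b\<bar> powr p \<le> t * \<bar>a\<bar> powr p + (1 - t) * \<bar>b\<bar> powr p"
proof -
  have scaled: "(s * x) powr p \<le> s * x powr p" if "0 \<le> s" "s \<le> 1" "0 \<le> x" for s x :: real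
  proof -
    have "s powr p \<le> s powr 1"
      using that assms by (intro powr_mono') auto
    then show ?thesis using that by (simp add: powr_mult mult_right_mono)
  qed
  have "\<bar>t * a + (1 - t) * b\<bar> \<le> t * \<bar>a\<bar> + (1 - t) * \<bar>b\<bar>"
    using abs_triangle_ineq[of "t * a" "(1 - t) * b"] assms by (simp add: abs_mult)
  then have "\<bar>t * a + (1 - t) * b\<bar> powr p \<le> (t * \<bar>a\<bar> + (1 - t) * \<bar>b\<bar>) powr p"
    using assms by (intro powr_mono2) auto
  also have "\<dots> \<le> t * \<bar>a\<bar> powr p + (1 - t) * \<bar>b\<bar> powr p"
  proof (cases "a = 0 \<or> b = 0")
    case True
    then show ?thesis
      using scaled[of t "\<bar>a\<bar>"] scaled[of "1 - t" "\<bar>b\<bar>"] assms by auto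
  next
    case False
    then show ?thesis
      using convex_onD[OF powr_convex[OF assms(1)], of "1 - t" "\<bar>a\<bar>" "\<bar>b\<bar>"] assms by simp
  qed
  finally show ?thesis .
qed

text \<open>Strict convexity, by the mean value theorem on the two halves of \<open>[t, 1]\<close> if \<open>t > 0\<close>: the derivative
  \<open>p * x powr (p - 1)\<close> is strictly larger on the right half.\<close>

lemma powr_midpoint_less:
  fixes t :: real
  assumes "1 < p" "0 \<le> t" "t < 1"
  shows "((1 + t) / 2) powr p < (1 + t powr p) / 2"
proof (cases "t = 0")
  case True
  have "(1 / 2 :: real) powr p < (1 / 2) powr 1"
    using assms by (intro powr_less_mono') auto
  then show ?thesis using True by simp
next
  case False
  define s where "s = (1 + t) / 2"
  have ts: "0 < t" "t < s" "s < 1" "1 - s = s - t" using False assms by (auto simp: s_def field_simps)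
  have D: "((\<lambda>x. x powr p) has_real_derivative p * x powr (p - 1)) (at x)" if "0 < x" for x
    using that by (auto intro!: derivative_eq_intros)
  obtain y where y: "s < y" "1 powr p - s powr p = (1 - s) * (p * y powr (p - 1))"
    using MVT2[of s 1 "\<lambda>x. x powr p" "\<lambda>x. p * x powr (p - 1)"] D ts by auto
  obtain x where x: "t < x" "x < s" "s powr p - t powr p = (s - t) * (p * x powr (p - 1))"
    using MVT2[of t s "\<lambda>x. x powr p" "\<lambda>x. p * x powr (p - 1)"] D ts by auto
  have "x powr (p - 1) < y powr (p - 1)"
    using x y ts assms by (intro powr_less_mono2) auto
  then have "(s - t) * (p * x powr (p - 1)) < (1 - s) * (p * y powr (p - 1))"
    unfolding \<open>1 - s = s - t\<close> using ts assms by (intro mult_strict_left_mono) auto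
  then show ?thesis using x y by (simp add: s_def)
qed

text \<open>Uniform convexity of \<open>\<bar>x\<bar> powr p\<close> in a form that is linear in the powers: rearranged, it says
  that \<open>\<bar>a - b\<bar> powr p\<close> is at most \<open>\<eta> * (\<bar>a\<bar> powr p + \<bar>b\<bar> powr p)\<close> plus \<open>C\<close> times the convexity defect at
  the midpoint. Linearity lets the inequality pass through any positive integral operator, and
  it holds for all \<open>p > 1\<close>, without the case distinction at \<open>p = 2\<close> of the inequalities of Clarkson.
  By symmetry and homogeneity one may take \<open>a = 1\<close> and \<open>b = t\<close> in \<open>[-1, 1]\<close>. For \<open>t\<close> close to \<open>1\<close> the
  difference term is below \<open>\<eta>\<close>, and on the remaining compact interval the defect has a positive minimum.\<close>

lemma abs_powr_uniformly_convex:
  fixes p \<eta> :: real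
  assumes "1 < p" "0 < \<eta>"
  obtains C where "0 \<le> C"
    "\<And>a b :: real. \<bar>a - b\<bar> powr p + C * \<bar>(a + b) / 2\<bar> powr p \<le> (\<eta> + C / 2) * (\<bar>a\<bar> powr p + \<bar>b\<bar> powr p)"
proof -
  define d where "d t = (1 + \<bar>t\<bar> powr p) / 2 - \<bar>(1 + t) / 2\<bar> powr p" for t :: real
  \<comment> \<open>For \<open>t > 1 - r\<close> the difference term is below \<open>r powr p = \<eta>\<close>.\<close>
  define r where "r = \<eta> powr (1 / p)"
  have r: "0 < r" "r powr p = \<eta>" using assms by (simp_all add: r_def powr_powr)
  have d_nonneg: "0 \<le> d t" for t
    using abs_powr_convex[of p "1 / 2" 1 t] assms by (simp add: d_def add_divide_distrib)
  have d_pos: "0 < d t" if "-1 \<le> t" "t < 1" for t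
  proof -
    have "\<bar>(1 + t) / 2\<bar> powr p \<le> ((1 + \<bar>t\<bar>) / 2) powr p"
      using assms by (intro powr_mono2) auto
    moreover have "((1 + \<bar>t\<bar>) / 2) powr p < (1 + \<bar>t\<bar> powr p) / 2" if "t \<noteq> - 1"
      using powr_midpoint_less[of p "\<bar>t\<bar>"] assms \<open>-1 \<le> t\<close> \<open>t < 1\<close> that by auto
    ultimately show ?thesis by (cases "t = - 1") (auto simp: d_def)
  qed
  obtain m where m: "0 < m" "\<And>t. -1 \<le> t \<Longrightarrow> t \<le> 1 - r \<Longrightarrow> m \<le> d t"
  proof (cases "-1 \<le> 1 - r")
    case True
    have "continuous_on {-1..1 - r} d"
      unfolding d_def using assms by (intro continuous_intros continuous_on_powr') auto
    then obtain t where "t \<in> {-1..1 - r}" "\<And>s. s \<in> {-1..1 - r} \<Longrightarrow> d t \<le> d s"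
      using continuous_attains_inf[of "{-1..1 - r}" d] True by auto
    then show ?thesis using r by (intro that[of "d t"] d_pos) auto
  next
    case False
    then show ?thesis by (intro that[of 1]) auto
  qed
  define C where "C = 2 powr p / m"
  have C: "0 \<le> C" using m by (simp add: C_def)
  have unit: "\<bar>1 - t\<bar> powr p + C * \<bar>(1 + t) / 2\<bar> powr p \<le> (\<eta> + C / 2) * (1 + \<bar>t\<bar> powr p)"
    if "\<bar>t\<bar> \<le> 1" for t
  proof -
    have "\<bar>1 - t\<bar> powr p \<le> \<eta> * (1 + \<bar>t\<bar> powr p) + C * d t"
    proof (cases "t \<le> 1 - r")
      case True
      have "\<bar>1 - t\<bar> powr p \<le> 2 powr p"
        using that assms by (intro powr_mono2) auto
      also have "\<dots> = C * m" using m by (simp add: C_def)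
      also have "\<dots> \<le> C * d t" using C m True that by (intro mult_left_mono) auto
      finally show ?thesis using assms by (simp add: add_increasing)
    next
      case False
      then have "\<bar>1 - t\<bar> powr p \<le> r powr p"
        using that assms by (intro powr_mono2) auto
      also have "\<dots> \<le> \<eta> * (1 + \<bar>t\<bar> powr p)" using r assms by simp
      finally show ?thesis using C d_nonneg[of t] by (simp add: add_increasing2)
    qed
    then show ?thesis by (simp add: d_def algebra_simps add_divide_distrib)
  qed
  have scaled: "\<bar>a - b\<bar> powr p + C * \<bar>(a + b) / 2\<bar> powr p \<le> (\<eta> + C / 2) * (\<bar>a\<bar> powr p + \<bar>b\<bar> powr p)"
    if "\<bar>b\<bar> \<le> \<bar>a\<bar>" for a b :: real
  proof (cases "a = 0")
    case False
    have "\<bar>b / a\<bar> \<le> 1" using that False by simp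
    note * = mult_right_mono[OF unit[OF this], of "\<bar>a\<bar> powr p"]
    have "\<bar>1 - b / a\<bar> * \<bar>a\<bar> = \<bar>a - b\<bar>" "\<bar>(1 + b / a) / 2\<bar> * \<bar>a\<bar> = \<bar>(a + b) / 2\<bar>"
      using False by (simp_all flip: abs_mult add: algebra_simps)
    moreover have "\<bar>b / a\<bar> * \<bar>a\<bar> = \<bar>b\<bar>" using False by simp
    ultimately have "\<bar>1 - b / a\<bar> powr p * \<bar>a\<bar> powr p = \<bar>a - b\<bar> powr p"
      "\<bar>(1 + b / a) / 2\<bar> powr p * \<bar>a\<bar> powr p = \<bar>(a + b) / 2\<bar> powr p"
      "\<bar>b / a\<bar> powr p * \<bar>a\<bar> powr p = \<bar>b\<bar> powr p"
      by (metis abs_ge_zero powr_mult)+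
    with * show ?thesis by (simp only: distrib_right mult.assoc mult_1) simp
  qed (use that in simp)
  show ?thesis
  proof (rule that[OF C])
    fix a b :: real
    show "\<bar>a - b\<bar> powr p + C * \<bar>(a + b) / 2\<bar> powr p \<le> (\<eta> + C / 2) * (\<bar>a\<bar> powr p + \<bar>b\<bar> powr p)"
      using scaled[of b a] scaled[of a b]
      by (cases "\<bar>b\<bar> \<le> \<bar>a\<bar>") (auto simp: abs_minus_commute add.commute)
  qed
qed

lemma riesz_kernel_nonneg:
  assumes "0 < \<alpha>" "\<alpha> < real CARD('n)"
  shows "0 \<le> riesz_kernel \<alpha> (x :: real ^ 'n::finite)"
  unfolding riesz_kernel_def riesz_const_def using assms
  by (intro mult_nonneg_nonneg divide_nonneg_nonneg less_imp_le[OF Gamma_real_pos]) auto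

lemma riesz_kernel_borel [measurable]: "riesz_kernel \<alpha> \<in> borel_measurable borel"
  unfolding riesz_kernel_def[abs_def] by measurable

lemma riesz_kernel_translate_lebesgue [measurable]:
  "(\<lambda>y. riesz_kernel \<alpha> (x - y)) \<in> borel_measurable lebesgue"
  by (intro measurable_completion) simp

text \<open>Joint measurability of the integrand, and hence measurability of the integral in \<open>x\<close>, is
  available after \<open>f\<close> has been replaced by a Borel function that agrees with it almost everywhere.\<close>

lemma riesz_conv_borel_measurable:
  fixes f :: "real ^ 'n::finite \<Rightarrow> real"
  assumes "f \<in> borel_measurable lebesgue"
  shows "riesz_conv \<alpha> f \<in> borel_measurable lebesgue"
proof -
  obtain g where [measurable]: "g \<in> borel_measurable lborel" and g: "AE x in lborel. f x = g x"
    using completion_ex_borel_measurable_real[OF assms] by blast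
  have "riesz_conv \<alpha> f = (\<lambda>x. \<integral>\<^sup>+ y. ennreal (riesz_kernel \<alpha> (x - y) * g y) \<partial>lborel)"
    unfolding riesz_conv_def nn_integral_completion
    by (intro ext nn_integral_cong_AE) (use g in \<open>auto elim: eventually_mono\<close>)
  also have "\<dots> \<in> borel_measurable lborel" by measurable
  finally show ?thesis by (rule measurable_completion)
qed

lemma riesz_conv_linear:
  fixes f g :: "real ^ 'n::finite \<Rightarrow> real"
  assumes \<alpha>: "0 < \<alpha>" "\<alpha> < real CARD('n)" and "0 \<le> a" "0 \<le> b"
    and [measurable]: "f \<in> borel_measurable lebesgue" "g \<in> borel_measurable lebesgue"
    and "\<And>x. 0 \<le> f x" "\<And>x. 0 \<le> g x"
  shows "riesz_conv \<alpha> (\<lambda>y. a * f y + b * g y) x = ennreal a * riesz_conv \<alpha> f x + ennreal b * riesz_conv \<alpha> g x"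
proof -
  note k = riesz_kernel_nonneg[OF \<alpha>]
  have "ennreal (riesz_kernel \<alpha> (x - y) * (a * f y + b * g y)) =
      ennreal a * ennreal (riesz_kernel \<alpha> (x - y) * f y) + ennreal b * ennreal (riesz_kernel \<alpha> (x - y) * g y)" for y
    using assms(3-) k[of "x - y"]
    by (simp add: ennreal_mult[symmetric] ennreal_plus[symmetric] algebra_simps del: ennreal_plus)
  then show ?thesis
    unfolding riesz_conv_def by (simp add: nn_integral_add nn_integral_cmult)
qed

lemma riesz_conv_mono:
  fixes f g :: "real ^ 'n::finite \<Rightarrow> real"
  assumes "0 < \<alpha>" "\<alpha> < real CARD('n)" and "\<And>y. f y \<le> g y"
  shows "riesz_conv \<alpha> f x \<le> riesz_conv \<alpha> g x"
  unfolding riesz_conv_def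
  by (intro nn_integral_mono ennreal_leI mult_left_mono riesz_kernel_nonneg assms)

lemma ennreal_square_convex:
  fixes m f g :: ennreal
  assumes m: "m \<le> ennreal t * f + ennreal (1 - t) * g" and t: "0 < t" "t < 1"
  shows "m\<^sup>2 \<le> ennreal t * f\<^sup>2 + ennreal (1 - t) * g\<^sup>2"
proof (cases "f = top \<or> g = top")
  case True
  then show ?thesis using t by (auto simp: ennreal_mult_top power2_eq_square ennreal_top_mult)
next
  case False
  then obtain x y where f: "f = ennreal x" "0 \<le> x" and g: "g = ennreal y" "0 \<le> y"
    by (metis ennreal_cases)
  have "m \<le> ennreal (t * x + (1 - t) * y)"
    using m t by (simp add: f g ennreal_mult)
  then have "m\<^sup>2 \<le> (ennreal (t * x + (1 - t) * y))\<^sup>2"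
    by (rule power_mono) simp
  also have "\<dots> = ennreal ((t * x + (1 - t) * y)\<^sup>2)"
    using t f g by (intro ennreal_power) auto
  also have "\<dots> \<le> ennreal (t * x\<^sup>2 + (1 - t) * y\<^sup>2)"
  proof (rule ennreal_leI)
    have "0 \<le> t * (1 - t) * (x - y)\<^sup>2" using t by simp
    then show "(t * x + (1 - t) * y)\<^sup>2 \<le> t * x\<^sup>2 + (1 - t) * y\<^sup>2"
      by (simp add: power2_eq_square algebra_simps)
  qed
  also have "\<dots> = ennreal t * f\<^sup>2 + ennreal (1 - t) * g\<^sup>2"
    using t by (simp add: f g ennreal_mult ennreal_power)
  finally show ?thesis .
qed

text \<open>With \<open>h = (f + g) / 2\<close> the first hypothesis reads \<open>d \<le> 2 * \<eta> * h + C * (h - m)\<close>. As \<open>m \<le> h\<close>,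
  squaring is harmless: \<open>(h - m)\<^sup>2 \<le> h\<^sup>2 - m\<^sup>2\<close>, so that the defect of the squares controls the
  square of the defect. The conclusion has the shape of the first hypothesis again, with
  \<open>4 * \<eta>\<^sup>2\<close> for \<open>\<eta>\<close> and \<open>2 * C\<^sup>2\<close> for \<open>C\<close>.\<close>

lemma ennreal_square_uniformly_convex:
  fixes d m f g :: ennreal
  assumes d: "d + ennreal C * m \<le> ennreal (\<eta> + C / 2) * (f + g)"
    and m: "m \<le> ennreal (1 / 2) * f + ennreal (1 - 1 / 2) * g" and "0 < \<eta>" "0 \<le> C"
  shows "d\<^sup>2 + ennreal (2 * C\<^sup>2) * m\<^sup>2 \<le> ennreal (4 * \<eta>\<^sup>2 + 2 * C\<^sup>2 / 2) * (f\<^sup>2 + g\<^sup>2)"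
proof (cases "f = top \<or> g = top")
  case True
  moreover have "0 < 4 * \<eta>\<^sup>2 + 2 * C\<^sup>2 / 2" using assms by (intro add_pos_nonneg) auto
  ultimately show ?thesis by (auto simp: ennreal_mult_top power2_eq_square)
next
  case False
  then obtain x y where f: "f = ennreal x" "0 \<le> x" and g: "g = ennreal y" "0 \<le> y"
    by (metis ennreal_cases)
  define h where "h = (x + y) / 2"
  have h: "0 \<le> h" using f g by (simp add: h_def)
  have "ennreal s * f + ennreal (1 - s) * g = ennreal (s * x + (1 - s) * y)" if "0 \<le> s" "s \<le> 1" for s
    using f g that by (simp add: ennreal_mult)
  from this[of "1 / 2"] have "ennreal (1 / 2) * f + ennreal (1 - 1 / 2) * g = ennreal (1 / 2 * x + (1 - 1 / 2) * y)"
    by simp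
  also have "1 / 2 * x + (1 - 1 / 2) * y = h" by (simp add: h_def field_simps)
  finally have "ennreal (1 / 2) * f + ennreal (1 - 1 / 2) * g = ennreal h" .
  with m have mh: "m \<le> ennreal h" by simp
  then obtain z where z: "m = ennreal z" "0 \<le> z" by (metis ennreal_cases top_unique ennreal_neq_top)
  have zh: "z \<le> h" using mh h by (simp add: z)
  have eq: "ennreal (\<eta> + C / 2) * (f + g) = ennreal ((2 * \<eta> + C) * h)"
    using f g assms by (simp add: h_def ennreal_mult[symmetric] ennreal_plus[symmetric] del: ennreal_plus)
  with d have "d \<le> ennreal ((2 * \<eta> + C) * h)"
    by (metis add_increasing2 order_trans le_add_same_cancel1 zero_le order_refl add_left_mono add.right_neutral)
  then obtain w where w: "d = ennreal w" "0 \<le> w" by (metis ennreal_cases top_unique ennreal_neq_top)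
  have "w + C * z \<le> (2 * \<eta> + C) * h"
    using d[unfolded eq] assms z w h by (simp add: ennreal_mult[symmetric] ennreal_plus[symmetric] del: ennreal_plus)
  then have "w \<le> 2 * \<eta> * h + C * (h - z)" by (simp add: algebra_simps)
  then have "w\<^sup>2 \<le> (2 * \<eta> * h + C * (h - z))\<^sup>2" using w by (intro power_mono) auto
  also have "\<dots> \<le> 2 * (2 * \<eta> * h)\<^sup>2 + 2 * (C * (h - z))\<^sup>2"
    using sum_squares_bound[of "2 * \<eta> * h" "C * (h - z)"] by (simp add: power2_sum)
  also have "\<dots> \<le> 8 * \<eta>\<^sup>2 * h\<^sup>2 + 2 * C\<^sup>2 * (h\<^sup>2 - z\<^sup>2)"
  proof -
    have "0 \<le> z * (h - z)" using z zh by simp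
    then have "(h - z)\<^sup>2 \<le> h\<^sup>2 - z\<^sup>2" by (simp add: power2_eq_square algebra_simps)
    then have "C\<^sup>2 * (h - z)\<^sup>2 \<le> C\<^sup>2 * (h\<^sup>2 - z\<^sup>2)" by (intro mult_left_mono) auto
    then show ?thesis by (simp add: power_mult_distrib)
  qed
  finally have "w\<^sup>2 + 2 * C\<^sup>2 * z\<^sup>2 \<le> (8 * \<eta>\<^sup>2 + 2 * C\<^sup>2) * h\<^sup>2" by (simp add: algebra_simps)
  also have "\<dots> \<le> (8 * \<eta>\<^sup>2 + 2 * C\<^sup>2) * ((x\<^sup>2 + y\<^sup>2) / 2)"
    using sum_squares_bound[of x y] by (intro mult_left_mono) (auto simp: h_def power2_sum power_divide)
  also have "\<dots> = (4 * \<eta>\<^sup>2 + 2 * C\<^sup>2 / 2) * (x\<^sup>2 + y\<^sup>2)" by (simp add: field_simps)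
  finally have "w\<^sup>2 + 2 * C\<^sup>2 * z\<^sup>2 \<le> (4 * \<eta>\<^sup>2 + 2 * C\<^sup>2 / 2) * (x\<^sup>2 + y\<^sup>2)" .
  from ennreal_leI[OF this] show ?thesis
    using f g z w by (simp add: ennreal_mult ennreal_power)
qed

lemma abs_powr_measurable_lebesgue:
  "u \<in> borel_measurable lebesgue \<Longrightarrow> (\<lambda>x. \<bar>u x :: real\<bar> powr p) \<in> borel_measurable lebesgue"
  by measurable

lemma coulomb_energy_scaleR:
  fixes u :: "'n::finite ae_fun"
  assumes \<alpha>: "0 < \<alpha>" "\<alpha> < real CARD('n)"
  shows "coulomb_energy \<alpha> p (c *\<^sub>R u) = ennreal (\<bar>c\<bar> powr (2 * p)) * coulomb_energy \<alpha> p u"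
proof -
  have "(\<integral>\<^sup>+ x. (riesz_conv (\<alpha> / 2) (\<lambda>y. \<bar>c * u y\<bar> powr p) x)\<^sup>2 \<partial>lebesgue) =
      ennreal (\<bar>c\<bar> powr (2 * p)) * (\<integral>\<^sup>+ x. (riesz_conv (\<alpha> / 2) (\<lambda>y. \<bar>u y\<bar> powr p) x)\<^sup>2 \<partial>lebesgue)"
    if u: "u \<in> borel_measurable lebesgue" for u :: "real ^ 'n \<Rightarrow> real"
  proof -
    note [measurable] = abs_powr_measurable_lebesgue[OF u]
    have "riesz_conv (\<alpha> / 2) (\<lambda>y. \<bar>c * u y\<bar> powr p) x =
        ennreal (\<bar>c\<bar> powr p) * riesz_conv (\<alpha> / 2) (\<lambda>y. \<bar>u y\<bar> powr p) x" for x
      using riesz_conv_linear[of "\<alpha> / 2" "\<bar>c\<bar> powr p" 0 "\<lambda>y. \<bar>u y\<bar> powr p" "\<lambda>y. \<bar>u y\<bar> powr p" x] \<alpha>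
      by (simp add: abs_mult powr_mult)
    moreover have "(ennreal (\<bar>c\<bar> powr p))\<^sup>2 = ennreal (\<bar>c\<bar> powr (2 * p))"
      by (simp add: ennreal_power power2_eq_square ennreal_mult[symmetric] flip: powr_add)
    moreover have "riesz_conv (\<alpha> / 2) (\<lambda>y. \<bar>u y\<bar> powr p) \<in> borel_measurable lebesgue"
      by (rule riesz_conv_borel_measurable) measurable
    ultimately show ?thesis
      by (simp add: power_mult_distrib nn_integral_cmult)
  qed
  then show ?thesis by transfer (simp add: ae_equal_def)
qed

text \<open>Convexity of \<open>\<bar>x\<bar> powr p\<close> survives the convolution with a nonnegative kernel, the squaring of
  nonnegative numbers and the integration.\<close>

lemma coulomb_energy_convex:
  fixes u v :: "'n::finite ae_fun"
  assumes \<alpha>: "0 < \<alpha>" "\<alpha> < real CARD('n)" and p: "1 < p" and t: "0 < t" "t < 1"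
  shows "coulomb_energy \<alpha> p (t *\<^sub>R u + (1 - t) *\<^sub>R v) \<le>
    ennreal t * coulomb_energy \<alpha> p u + ennreal (1 - t) * coulomb_energy \<alpha> p v"
proof -
  define F where "F u = riesz_conv (\<alpha> / 2) (\<lambda>y. \<bar>u y\<bar> powr p)" for u :: "real ^ 'n \<Rightarrow> real"
  have "(\<integral>\<^sup>+ x. (F (\<lambda>y. t * u y + (1 - t) * v y) x)\<^sup>2 \<partial>lebesgue) \<le>
      ennreal t * (\<integral>\<^sup>+ x. (F u x)\<^sup>2 \<partial>lebesgue) + ennreal (1 - t) * (\<integral>\<^sup>+ x. (F v x)\<^sup>2 \<partial>lebesgue)"
    if u: "u \<in> borel_measurable lebesgue" and v: "v \<in> borel_measurable lebesgue" for u v :: "real ^ 'n \<Rightarrow> real"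
  proof -
    have [measurable]: "F u \<in> borel_measurable lebesgue" "F v \<in> borel_measurable lebesgue"
      unfolding F_def by (intro riesz_conv_borel_measurable abs_powr_measurable_lebesgue u v)+
    have "F (\<lambda>y. t * u y + (1 - t) * v y) x \<le> ennreal t * F u x + ennreal (1 - t) * F v x" for x
    proof -
      have "F (\<lambda>y. t * u y + (1 - t) * v y) x \<le>
          riesz_conv (\<alpha> / 2) (\<lambda>y. t * \<bar>u y\<bar> powr p + (1 - t) * \<bar>v y\<bar> powr p) x"
        unfolding F_def using \<alpha> p t by (intro riesz_conv_mono abs_powr_convex) auto
      also have "\<dots> = ennreal t * F u x + ennreal (1 - t) * F v x"
        unfolding F_def using \<alpha> t
        by (intro riesz_conv_linear abs_powr_measurable_lebesgue u v) auto
      finally show ?thesis .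
    qed
    then have "(\<integral>\<^sup>+ x. (F (\<lambda>y. t * u y + (1 - t) * v y) x)\<^sup>2 \<partial>lebesgue) \<le>
        (\<integral>\<^sup>+ x. ennreal t * (F u x)\<^sup>2 + ennreal (1 - t) * (F v x)\<^sup>2 \<partial>lebesgue)"
      by (intro nn_integral_mono ennreal_square_convex t)
    also have "\<dots> = ennreal t * (\<integral>\<^sup>+ x. (F u x)\<^sup>2 \<partial>lebesgue) + ennreal (1 - t) * (\<integral>\<^sup>+ x. (F v x)\<^sup>2 \<partial>lebesgue)"
      by (simp add: nn_integral_add nn_integral_cmult)
    finally show ?thesis .
  qed
  then show ?thesis unfolding F_def by transfer (simp add: ae_equal_def)
qed

text \<open>The scalar inequality is convolved with the kernel, squared and integrated. Each of the three
  operations preserves its shape.\<close>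

lemma coulomb_energy_uniformly_convex:
  fixes \<alpha> p \<eta> :: real
  assumes \<alpha>: "0 < \<alpha>" "\<alpha> < real CARD('n::finite)" and p: "1 < p" and "0 < \<eta>"
  obtains C where "0 \<le> C"
    "\<And>u v :: 'n ae_fun. coulomb_energy \<alpha> p (u - v) + ennreal C * coulomb_energy \<alpha> p ((1 / 2) *\<^sub>R (u + v))
      \<le> ennreal (\<eta> + C / 2) * (coulomb_energy \<alpha> p u + coulomb_energy \<alpha> p v)"
proof -
  define F where "F u = riesz_conv (\<alpha> / 2) (\<lambda>y. \<bar>u y\<bar> powr p)" for u :: "real ^ 'n \<Rightarrow> real"
  \<comment> \<open>Squaring turns the parameter \<open>\<kappa>\<close> into \<open>4 * \<kappa>\<^sup>2\<close>.\<close>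
  define \<kappa> where "\<kappa> = sqrt \<eta> / 2"
  have \<kappa>: "0 < \<kappa>" "4 * \<kappa>\<^sup>2 = \<eta>" using \<open>0 < \<eta>\<close> by (simp_all add: \<kappa>_def power_divide)
  obtain C where C: "0 \<le> C"
    "\<And>a b :: real. \<bar>a - b\<bar> powr p + C * \<bar>(a + b) / 2\<bar> powr p \<le> (\<kappa> + C / 2) * (\<bar>a\<bar> powr p + \<bar>b\<bar> powr p)"
    using abs_powr_uniformly_convex[OF p \<kappa>(1)] by blast
  have "(\<integral>\<^sup>+ x. (F (\<lambda>y. u y - v y) x)\<^sup>2 \<partial>lebesgue) +
      ennreal (2 * C\<^sup>2) * (\<integral>\<^sup>+ x. (F (\<lambda>y. 1 / 2 * (u y + v y)) x)\<^sup>2 \<partial>lebesgue) \<le>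
      ennreal (\<eta> + 2 * C\<^sup>2 / 2) * ((\<integral>\<^sup>+ x. (F u x)\<^sup>2 \<partial>lebesgue) + (\<integral>\<^sup>+ x. (F v x)\<^sup>2 \<partial>lebesgue))"
    if u: "u \<in> borel_measurable lebesgue" and v: "v \<in> borel_measurable lebesgue" for u v :: "real ^ 'n \<Rightarrow> real"
  proof -
    let ?d = "\<lambda>y. u y - v y" and ?m = "\<lambda>y. 1 / 2 * (u y + v y)"
    have d: "?d \<in> borel_measurable lebesgue" and m: "?m \<in> borel_measurable lebesgue"
      using u v by measurable
    have [measurable]: "F w \<in> borel_measurable lebesgue" if "w \<in> {u, v, ?d, ?m}" for w
      unfolding F_def
      by (rule riesz_conv_borel_measurable, rule abs_powr_measurable_lebesgue) (use that u v d m in auto)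
    have "F ?m x \<le> ennreal (1 / 2) * F u x + ennreal (1 - 1 / 2) * F v x" for x
    proof -
      have "\<bar>?m y\<bar> powr p \<le> 1 / 2 * \<bar>u y\<bar> powr p + (1 - 1 / 2) * \<bar>v y\<bar> powr p" for y
        using abs_powr_convex[of p "1 / 2" "u y" "v y"] p by (simp add: add_divide_distrib)
      then have "F ?m x \<le> riesz_conv (\<alpha> / 2) (\<lambda>y. 1 / 2 * \<bar>u y\<bar> powr p + (1 - 1 / 2) * \<bar>v y\<bar> powr p) x"
        unfolding F_def using \<alpha> by (intro riesz_conv_mono) auto
      also have "\<dots> = ennreal (1 / 2) * F u x + ennreal (1 - 1 / 2) * F v x"
        unfolding F_def using \<alpha>
        by (intro riesz_conv_linear abs_powr_measurable_lebesgue u v) auto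
      finally show ?thesis .
    qed
    moreover have "F ?d x + ennreal C * F ?m x \<le> ennreal (\<kappa> + C / 2) * (F u x + F v x)" for x
    proof -
      have "F ?d x + ennreal C * F ?m x =
          riesz_conv (\<alpha> / 2) (\<lambda>y. 1 * \<bar>?d y\<bar> powr p + C * \<bar>?m y\<bar> powr p) x"
        unfolding F_def using \<alpha> C
        by (subst riesz_conv_linear[OF _ _ _ _ abs_powr_measurable_lebesgue[OF d]
              abs_powr_measurable_lebesgue[OF m]]) auto
      also have "\<dots> \<le> riesz_conv (\<alpha> / 2)
          (\<lambda>y. (\<kappa> + C / 2) * \<bar>u y\<bar> powr p + (\<kappa> + C / 2) * \<bar>v y\<bar> powr p) x"
        using \<alpha> C(2) by (intro riesz_conv_mono) (auto simp: distrib_left[of "\<kappa> + C / 2"])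
      also have "\<dots> = ennreal (\<kappa> + C / 2) * (F u x + F v x)"
        unfolding F_def distrib_left using \<alpha> C \<kappa>
        by (intro riesz_conv_linear abs_powr_measurable_lebesgue u v) auto
      finally show ?thesis .
    qed
    ultimately have "(F ?d x)\<^sup>2 + ennreal (2 * C\<^sup>2) * (F ?m x)\<^sup>2 \<le>
        ennreal (\<eta> + 2 * C\<^sup>2 / 2) * ((F u x)\<^sup>2 + (F v x)\<^sup>2)" for x
      using ennreal_square_uniformly_convex[of "F ?d x" C "F ?m x" \<kappa>] \<kappa> C by blast
    then have "(\<integral>\<^sup>+ x. (F ?d x)\<^sup>2 + ennreal (2 * C\<^sup>2) * (F ?m x)\<^sup>2 \<partial>lebesgue) \<le>
        (\<integral>\<^sup>+ x. ennreal (\<eta> + 2 * C\<^sup>2 / 2) * ((F u x)\<^sup>2 + (F v x)\<^sup>2) \<partial>lebesgue)"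
      by (intro nn_integral_mono)
    then show ?thesis
      by (simp add: nn_integral_add nn_integral_cmult)
  qed
  then have "coulomb_energy \<alpha> p (u - v) + ennreal (2 * C\<^sup>2) * coulomb_energy \<alpha> p ((1 / 2) *\<^sub>R (u + v))
      \<le> ennreal (\<eta> + 2 * C\<^sup>2 / 2) * (coulomb_energy \<alpha> p u + coulomb_energy \<alpha> p v)" for u v :: "'n ae_fun"
    unfolding F_def by transfer (simp add: ae_equal_def)
  then show ?thesis by (intro that[of "2 * C\<^sup>2"]) auto
qed

section \<open>Uniform convexity of a sum of two energies\<close>

text \<open>The unit ball of a homogeneous convex functional is convex, which is the triangle inequality for
  its root.\<close>

lemma powr_root_triangle:
  fixes B :: "'v::real_vector \<Rightarrow> real"
  assumes V: "subspace V" and r: "0 < r"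
    and nonneg: "\<And>u. u \<in> V \<Longrightarrow> 0 \<le> B u"
    and homogeneous: "\<And>u c. u \<in> V \<Longrightarrow> B (c *\<^sub>R u) = \<bar>c\<bar> powr r * B u"
    and convex: "\<And>u v t. u \<in> V \<Longrightarrow> v \<in> V \<Longrightarrow> 0 < t \<Longrightarrow> t < 1 \<Longrightarrow>
      B (t *\<^sub>R u + (1 - t) *\<^sub>R v) \<le> t * B u + (1 - t) * B v"
    and uv: "u \<in> V" "v \<in> V"
  shows "B (u + v) powr (1 / r) \<le> B u powr (1 / r) + B v powr (1 / r)"
proof (rule field_le_epsilon)
  have scale: "B (inverse c *\<^sub>R w) = B w / c powr r" if "w \<in> V" "0 < c" for w c
    using that by (simp add: homogeneous inverse_powr) (simp add: divide_inverse)
  have unit: "B (inverse c *\<^sub>R w) \<le> 1" if "w \<in> V" "B w powr (1 / r) \<le> c" "0 < c" for w c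
  proof -
    have "(B w powr (1 / r)) powr r \<le> c powr r"
      using that r by (intro powr_mono2) auto
    then have "B w \<le> c powr r" using nonneg[OF \<open>w \<in> V\<close>] r by (simp add: powr_powr)
    then show ?thesis
      using that by (simp add: scale)
  qed
  fix e :: real
  assume "0 < e"
  \<comment> \<open>The summand \<open>e / 2\<close> keeps \<open>a\<close> and \<open>b\<close> positive, also where the functional vanishes.\<close>
  define a b where "a = B u powr (1 / r) + e / 2" and "b = B v powr (1 / r) + e / 2"
  have ab: "0 < a" "0 < b" using \<open>0 < e\<close> by (simp_all add: a_def b_def add_nonneg_pos)
  define t where "t = a / (a + b)"
  have t: "0 < t" "t < 1" "1 - t = b / (a + b)" using ab by (simp_all add: t_def field_simps)
  have "inverse (a + b) *\<^sub>R (u + v) = t *\<^sub>R (inverse a *\<^sub>R u) + (1 - t) *\<^sub>R (inverse b *\<^sub>R v)"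
  proof -
    have "t * inverse a = inverse (a + b)" "(1 - t) * inverse b = inverse (a + b)"
      unfolding t(3) using ab by (simp_all add: t_def field_simps)
    then show ?thesis by (simp add: scaleR_add_right)
  qed
  then have "B (inverse (a + b) *\<^sub>R (u + v)) \<le> t * B (inverse a *\<^sub>R u) + (1 - t) * B (inverse b *\<^sub>R v)"
    using convex[of "inverse a *\<^sub>R u" "inverse b *\<^sub>R v" t] uv t V by (simp add: subspace_scale)
  also have "\<dots> \<le> t * 1 + (1 - t) * 1"
    using uv t ab \<open>0 < e\<close> by (intro add_mono mult_left_mono unit) (auto simp: a_def b_def)
  finally have "B (inverse (a + b) *\<^sub>R (u + v)) \<le> 1" by simp
  then have "B (u + v) \<le> (a + b) powr r"
    using uv V ab by (simp add: scale subspace_add)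
  then have "B (u + v) powr (1 / r) \<le> ((a + b) powr r) powr (1 / r)"
    using r uv V by (intro powr_mono2 nonneg subspace_add) auto
  also have "\<dots> = a + b" using ab r by (simp add: powr_powr)
  finally show "B (u + v) powr (1 / r) \<le> B u powr (1 / r) + B v powr (1 / r) + e"
    by (simp add: a_def b_def)
qed

lemma powr_uniformly_continuous_unit:
  fixes r \<eta> :: real
  assumes "0 < r" "0 < \<eta>"
  obtains \<delta> where "0 < \<delta>" "\<And>x y. 0 \<le> x \<Longrightarrow> x \<le> y \<Longrightarrow> y \<le> 1 \<Longrightarrow> y < x + \<delta> \<Longrightarrow> y powr r < x powr r + \<eta>"
proof -
  have "continuous_on {0..1::real} (\<lambda>x. x powr r)"
    using assms by (intro continuous_on_powr' continuous_intros) auto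
  then have "uniformly_continuous_on {0..1::real} (\<lambda>x. x powr r)"
    by (intro compact_uniformly_continuous) auto
  then obtain \<delta> where "0 < \<delta>" and
    \<delta>: "\<And>x y. x \<in> {0..1} \<Longrightarrow> y \<in> {0..1} \<Longrightarrow> dist y x < \<delta> \<Longrightarrow> dist (y powr r) (x powr r) < \<eta>"
    using \<open>0 < \<eta>\<close> unfolding uniformly_continuous_on_def by metis
  show ?thesis
  proof (rule that[OF \<open>0 < \<delta>\<close>])
    fix x y :: real
    assume "0 \<le> x" "x \<le> y" "y \<le> 1" "y < x + \<delta>"
    then show "y powr r < x powr r + \<eta>"
      using \<delta>[of x y] by (simp add: dist_real_def)
  qed
qed

text \<open>Put \<open>q = B powr (1 / r)\<close>, a seminorm, and let \<open>m\<close> be the midpoint of unit vectors \<open>u\<close> and \<open>v\<close>.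
  The parallelogram law gives
  \<open>A m + (q m)\<^sup>2 = 1 - A (u - v) / 4 - ((q u - q v) / 2)\<^sup>2 - (((q u + q v) / 2)\<^sup>2 - (q m)\<^sup>2)\<close>,
  where the subtracted terms are nonnegative, the last one by the triangle inequality for \<open>q\<close>.
  If the left side is close to \<open>1\<close>, all of them are
  small. So \<open>A (u - v)\<close> is small, and \<open>q u\<close>, \<open>q v\<close> and \<open>q m\<close> are close to each other. Hence the
  convexity defect of \<open>B = q powr r\<close> is small, and the modulus of convexity of \<open>B\<close> makes \<open>B (u - v)\<close>
  small as well.\<close>

lemma uniformly_convex_sqrt_add:
  fixes A B :: "'v::real_vector \<Rightarrow> real"
  assumes V: "subspace V" and r: "0 < r"
    and A_nonneg: "\<And>u. u \<in> V \<Longrightarrow> 0 \<le> A u"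
    and parallelogram: "\<And>u v. u \<in> V \<Longrightarrow> v \<in> V \<Longrightarrow> A (u + v) + A (u - v) = 2 * A u + 2 * A v"
    and B_nonneg: "\<And>u. u \<in> V \<Longrightarrow> 0 \<le> B u"
    and homogeneous: "\<And>u c. u \<in> V \<Longrightarrow> B (c *\<^sub>R u) = \<bar>c\<bar> powr r * B u"
    and convex: "\<And>u v t. u \<in> V \<Longrightarrow> v \<in> V \<Longrightarrow> 0 < t \<Longrightarrow> t < 1 \<Longrightarrow>
      B (t *\<^sub>R u + (1 - t) *\<^sub>R v) \<le> t * B u + (1 - t) * B v"
    and modulus: "\<And>\<eta>. 0 < \<eta> \<Longrightarrow> \<exists>C\<ge>0. \<forall>u\<in>V. \<forall>v\<in>V.
      B (u - v) + C * B ((1 / 2) *\<^sub>R (u + v)) \<le> (\<eta> + C / 2) * (B u + B v)"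
  shows "uniformly_convex V (\<lambda>u. sqrt (A u + B u powr (2 / r)))"
  unfolding uniformly_convex_def
proof (intro allI impI)
  define q where "q u = B u powr (1 / r)" for u
  have q_nonneg: "0 \<le> q u" for u by (simp add: q_def)
  have q_powr: "q u powr r = B u" if "u \<in> V" for u
    using B_nonneg[OF that] r by (simp add: q_def powr_powr)
  have q_square: "B u powr (2 / r) = (q u)\<^sup>2" for u
    by (simp add: q_def power2_eq_square flip: powr_add)
  have mid: "(1 / 2) *\<^sub>R (u + v) \<in> V" if "u \<in> V" "v \<in> V" for u v
    using that V by (intro subspace_scale subspace_add)
  have q_mid: "q ((1 / 2) *\<^sub>R (u + v)) \<le> (q u + q v) / 2" if "u \<in> V" "v \<in> V" for u v
  proof -
    have "q (c *\<^sub>R w) = \<bar>c\<bar> * q w" if "w \<in> V" for c w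
      using B_nonneg[OF that] r by (simp add: q_def homogeneous[OF that] powr_mult powr_powr)
    moreover have "q (u + v) \<le> q u + q v"
      unfolding q_def by (rule powr_root_triangle[OF V r B_nonneg homogeneous convex that])
    ultimately show ?thesis using that V by (simp add: subspace_add)
  qed
  have A_mid: "A ((1 / 2) *\<^sub>R (u + v)) = (A u + A v) / 2 - A (u - v) / 4" if "u \<in> V" "v \<in> V" for u v
  proof -
    define m where "m = (1 / 2) *\<^sub>R (u + v)"
    have "A 0 = 0" using parallelogram[of 0 0] V by (simp add: subspace_0)
    moreover have "m + m = u + v" by (simp add: m_def flip: scaleR_left_distrib)
    moreover have "m \<in> V" using mid[OF that] by (simp add: m_def)
    ultimately have "A (u + v) = 4 * A m"
      using parallelogram[of m m] by simp
    then show ?thesis using parallelogram[OF that] unfolding m_def[symmetric] by (simp add: field_simps)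
  qed
  fix \<epsilon> :: real
  assume "0 < \<epsilon>"
  \<comment> \<open>This makes \<open>3 * \<eta>\<close> the bound on \<open>B (u - v)\<close> that corresponds to \<open>q (u - v) \<le> \<epsilon> / 2\<close>.\<close>
  define \<eta> where "\<eta> = (\<epsilon> / 2) powr r / 3"
  have \<eta>: "0 < \<eta>" using \<open>0 < \<epsilon>\<close> by (simp add: \<eta>_def)
  obtain C where C: "0 \<le> C" and
    C_modulus: "\<And>u v. u \<in> V \<Longrightarrow> v \<in> V \<Longrightarrow> B (u - v) + C * B ((1 / 2) *\<^sub>R (u + v)) \<le> (\<eta> + C / 2) * (B u + B v)"
    using modulus[OF \<eta>] by blast
  define \<kappa> where "\<kappa> = \<eta> / (C + 1)"
  have \<kappa>: "0 < \<kappa>" "C * \<kappa> \<le> \<eta>" using \<eta> C by (simp_all add: \<kappa>_def field_simps)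
  from powr_uniformly_continuous_unit[OF r \<kappa>(1)] obtain \<tau> where \<tau>: "0 < \<tau>"
    "\<And>x y. 0 \<le> x \<Longrightarrow> x \<le> y \<Longrightarrow> y \<le> 1 \<Longrightarrow> y < x + \<tau> \<Longrightarrow> y powr r < x powr r + \<kappa>" by blast
  \<comment> \<open>The three small terms will be bounded by multiples of \<open>\<rho>\<^sup>2\<close>: \<open>2 * \<rho> \<le> \<tau>\<close> serves \<open>B (u - v)\<close>, and
    \<open>4 * \<rho> \<le> \<epsilon>\<close> serves \<open>A (u - v)\<close>.\<close>
  define \<rho> where "\<rho> = min (\<tau> / 2) (\<epsilon> / 4)"
  have \<rho>: "0 < \<rho>" "2 * \<rho> \<le> \<tau>" "4 * \<rho> \<le> \<epsilon>" using \<tau> \<open>0 < \<epsilon>\<close> by (auto simp: \<rho>_def)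
  define \<delta> where "\<delta> = min 1 (\<rho>\<^sup>2 / 2)"
  have \<delta>: "0 < \<delta>" "\<delta> \<le> 1" "2 * \<delta> \<le> \<rho>\<^sup>2" using \<rho> by (auto simp: \<delta>_def)
  have close: "sqrt (A (u - v) + B (u - v) powr (2 / r)) < \<epsilon>"
    if uv: "u \<in> V" "v \<in> V" and u1: "A u + (q u)\<^sup>2 = 1" and v1: "A v + (q v)\<^sup>2 = 1"
      and m1: "1 - \<delta> < sqrt (A ((1 / 2) *\<^sub>R (u + v)) + (q ((1 / 2) *\<^sub>R (u + v)))\<^sup>2)" for u v
  proof -
    define w m s where "w = u - v" and "m = (1 / 2) *\<^sub>R (u + v)" and "s = (q u + q v) / 2"
    have V': "w \<in> V" "m \<in> V" using uv V by (auto simp: w_def m_def intro: subspace_diff mid)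
    have "(1 - \<delta>)\<^sup>2 < (sqrt (A m + (q m)\<^sup>2))\<^sup>2"
      using m1 \<delta> unfolding m_def by (intro power_strict_mono) auto
    also have "\<dots> = A m + (q m)\<^sup>2" using A_nonneg[OF V'(2)] by simp
    finally have "1 - \<rho>\<^sup>2 < A m + (q m)\<^sup>2"
      using \<delta> zero_le_power2[of \<delta>] unfolding power2_diff power_one by linarith
    moreover have "A m = 1 - ((q u)\<^sup>2 + (q v)\<^sup>2) / 2 - A w / 4"
      using A_mid[OF uv, folded m_def w_def] u1 v1 by (simp add: field_simps)
    moreover have "((q u)\<^sup>2 + (q v)\<^sup>2) / 2 = s\<^sup>2 + ((q u - q v) / 2)\<^sup>2"
      by (simp add: s_def power2_eq_square field_simps)
    ultimately have main: "s\<^sup>2 + ((q u - q v) / 2)\<^sup>2 + A w / 4 < (q m)\<^sup>2 + \<rho>\<^sup>2"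
      by simp
    have ms: "q m \<le> s" using q_mid[OF uv] by (simp add: m_def s_def)
    then have ms2: "(q m)\<^sup>2 \<le> s\<^sup>2" using q_nonneg by (intro power_mono)
    have Aw: "A w < 4 * \<rho>\<^sup>2"
      using main ms2 zero_le_power2[of "(q u - q v) / 2"] by linarith
    have "((q u - q v) / 2)\<^sup>2 < \<rho>\<^sup>2" using main ms2 A_nonneg[OF V'(1)] by linarith
    then have "\<bar>(q u - q v) / 2\<bar> < \<rho>" using \<rho> by (intro power2_less_imp_less[of "\<bar>(q u - q v) / 2\<bar>" \<rho>])
      (simp_all only: power2_abs less_imp_le)
    moreover have "s < q m + \<rho>"
    proof (rule power2_less_imp_less)
      have "s\<^sup>2 < (q m)\<^sup>2 + \<rho>\<^sup>2"
        using main A_nonneg[OF V'(1)] zero_le_power2[of "(q u - q v) / 2"] by linarith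
      also have "\<dots> \<le> (q m + \<rho>)\<^sup>2" using q_nonneg[of m] \<rho> by (simp add: power2_sum)
      finally show "s\<^sup>2 < (q m + \<rho>)\<^sup>2" .
    qed (use q_nonneg[of m] \<rho> in simp)
    ultimately have near: "q x < q m + 2 * \<rho>" if "x \<in> {u, v}" for x
      using that by (auto simp: s_def abs_less_iff)
    have q_le_1: "q x \<le> 1" if "x \<in> {u, v}" for x
    proof (rule power2_le_imp_le)
      show "(q x)\<^sup>2 \<le> 1\<^sup>2"
        using that u1 v1 A_nonneg[OF uv(1)] A_nonneg[OF uv(2)] by auto
    qed simp
    have B_near: "B x \<le> B m + \<kappa>" if "x \<in> {u, v}" for x
    proof (cases "q x \<le> q m")
      case True
      then have "q x powr r \<le> q m powr r" using q_nonneg r by (intro powr_mono2) auto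
      then show ?thesis using that uv V' \<kappa> by (auto simp: q_powr add_increasing2)
    next
      case False
      have "q x powr r < q m powr r + \<kappa>"
        using False near[OF that] q_le_1[OF that] \<rho> q_nonneg by (intro \<tau>(2)) auto
      then show ?thesis using that uv V' by (auto simp: q_powr)
    qed
    have B_le_1: "B x \<le> 1" if "x \<in> {u, v}" for x
    proof -
      have "q x powr r \<le> 1 powr r" using q_nonneg q_le_1[OF that] r by (intro powr_mono2) auto
      then show ?thesis using that uv by (auto simp: q_powr)
    qed
    have B_gap: "(B u + B v) / 2 - B m \<le> \<kappa>"
      using B_near[of u] B_near[of v] by (simp add: field_simps)
    have "B w \<le> \<eta> * (B u + B v) + C * ((B u + B v) / 2 - B m)"
      using C_modulus[OF uv] by (simp add: w_def m_def algebra_simps)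
    also have "\<dots> \<le> \<eta> * 2 + C * (\<kappa>)"
      using B_gap B_le_1[of u] B_le_1[of v] \<eta> C
      by (intro add_mono mult_left_mono) auto
    also have "\<dots> \<le> 3 * \<eta>" using \<kappa> by simp
    finally have "B w \<le> (\<epsilon> / 2) powr r" by (simp add: \<eta>_def)
    then have "B w powr (1 / r) \<le> ((\<epsilon> / 2) powr r) powr (1 / r)"
      using B_nonneg[OF V'(1)] r by (intro powr_mono2) auto
    then have "q w \<le> \<epsilon> / 2" using r \<open>0 < \<epsilon>\<close> by (simp add: q_def powr_powr)
    then have "(q w)\<^sup>2 \<le> (\<epsilon> / 2)\<^sup>2" using q_nonneg by (intro power_mono)
    moreover have "4 * \<rho>\<^sup>2 \<le> \<epsilon>\<^sup>2 / 4"
      using power_mono[of "4 * \<rho>" \<epsilon> 2] \<rho> by (simp add: power_mult_distrib)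
    moreover have "(\<epsilon> / 2)\<^sup>2 + \<epsilon>\<^sup>2 / 4 \<le> \<epsilon>\<^sup>2" by (simp add: power_divide)
    ultimately have "A w + (q w)\<^sup>2 < \<epsilon>\<^sup>2"
      using Aw by linarith
    then have "sqrt (A w + (q w)\<^sup>2) < sqrt (\<epsilon>\<^sup>2)" by (rule real_sqrt_less_mono)
    then show ?thesis using \<open>0 < \<epsilon>\<close> by (simp add: q_square w_def)
  qed
  show "\<exists>\<delta>>0. \<forall>u\<in>V. \<forall>v\<in>V. sqrt (A u + B u powr (2 / r)) = 1 \<longrightarrow> sqrt (A v + B v powr (2 / r)) = 1 \<longrightarrow>
      \<epsilon> \<le> sqrt (A (u - v) + B (u - v) powr (2 / r)) \<longrightarrow>
      sqrt (A ((1 / 2) *\<^sub>R (u + v)) + B ((1 / 2) *\<^sub>R (u + v)) powr (2 / r)) \<le> 1 - \<delta>"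
  proof (intro exI[of _ \<delta>] conjI ballI impI \<delta>(1))
    fix u v
    assume *: "u \<in> V" "v \<in> V" "sqrt (A u + B u powr (2 / r)) = 1" "sqrt (A v + B v powr (2 / r)) = 1"
      "\<epsilon> \<le> sqrt (A (u - v) + B (u - v) powr (2 / r))"
    show "sqrt (A ((1 / 2) *\<^sub>R (u + v)) + B ((1 / 2) *\<^sub>R (u + v)) powr (2 / r)) \<le> 1 - \<delta>"
      using close[of u v] * unfolding q_square by (auto simp: not_less[symmetric])
  qed
qed

section \<open>The Coulomb--Sobolev space\<close>

text \<open>Finiteness of the energies of a sum comes from the parallelogram law and, after writing
  \<open>u + v\<close> as twice a midpoint, from homogeneity and convexity of the Coulomb energy.\<close>

lemma subspace_coulomb_sobolev:
  assumes \<alpha>: "0 < \<alpha>" "\<alpha> < real CARD('n::finite)" and p: "1 < p"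
  shows "subspace (coulomb_sobolev \<alpha> p :: 'n ae_fun set)"
proof (rule subspaceI)
  show "0 \<in> (coulomb_sobolev \<alpha> p :: 'n ae_fun set)"
    using coulomb_energy_scaleR[OF \<alpha>, of p 0 "0 :: 'n ae_fun"]
      dirichlet_energy_scaleR[OF weakly_differentiable_0[where 'n = 'n], of 0] p
    by (simp add: coulomb_sobolev_def weakly_differentiable_0)
next
  fix c and u :: "'n ae_fun"
  assume "u \<in> coulomb_sobolev \<alpha> p"
  then show "c *\<^sub>R u \<in> coulomb_sobolev \<alpha> p"
    by (simp add: coulomb_sobolev_def coulomb_energy_scaleR[OF \<alpha>] dirichlet_energy_scaleR
        weakly_differentiable_scaleR ennreal_mult_less_top)
next
  fix u v :: "'n ae_fun"
  assume uv: "u \<in> coulomb_sobolev \<alpha> p" "v \<in> coulomb_sobolev \<alpha> p"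
  have "dirichlet_energy (u + v) \<le> 2 * dirichlet_energy u + 2 * dirichlet_energy v"
    using uv by (subst dirichlet_energy_parallelogram[symmetric]) (auto simp: coulomb_sobolev_def)
  also have "\<dots> < \<infinity>"
    using uv by (simp add: coulomb_sobolev_def ennreal_mult_less_top)
  finally have D: "dirichlet_energy (u + v) < \<infinity>" .
  have "u + v = 2 *\<^sub>R ((1 / 2) *\<^sub>R u + (1 - 1 / 2) *\<^sub>R v)"
    by (simp add: scaleR_add_right)
  then have "coulomb_energy \<alpha> p (u + v) =
      ennreal (\<bar>2\<bar> powr (2 * p)) * coulomb_energy \<alpha> p ((1 / 2) *\<^sub>R u + (1 - 1 / 2) *\<^sub>R v)"
    by (simp only: coulomb_energy_scaleR[OF \<alpha>])
  also have "\<dots> \<le> ennreal (\<bar>2\<bar> powr (2 * p)) *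
      (ennreal (1 / 2) * coulomb_energy \<alpha> p u + ennreal (1 - 1 / 2) * coulomb_energy \<alpha> p v)"
    by (intro mult_left_mono coulomb_energy_convex[OF \<alpha> p]) auto
  also have "ennreal k * (ennreal s * coulomb_energy \<alpha> p u + ennreal t * coulomb_energy \<alpha> p v) < \<infinity>" for k s t
    using uv by (simp add: coulomb_sobolev_def ennreal_mult_less_top)
  finally show "u + v \<in> coulomb_sobolev \<alpha> p"
    using D uv by (simp add: coulomb_sobolev_def weakly_differentiable_add)
qed

theorem proposition2p9:
  fixes \<alpha> p :: real
  assumes "0 < \<alpha>" and "\<alpha> < real CARD('n::finite)" and "1 < p"
  shows "uniformly_convex (coulomb_sobolev \<alpha> p :: 'n ae_fun set) (coulomb_sobolev_norm \<alpha> p)"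
proof -
  let ?V = "coulomb_sobolev \<alpha> p :: 'n ae_fun set"
  define A where "A u = enn2real (dirichlet_energy u)" for u :: "'n ae_fun"
  define B where "B u = enn2real (coulomb_energy \<alpha> p u)" for u :: "'n ae_fun"
  have nonneg: "0 \<le> A u" "0 \<le> B u" for u by (simp_all add: A_def B_def)
  have fin: "dirichlet_energy u = ennreal (A u)" "coulomb_energy \<alpha> p u = ennreal (B u)" if "u \<in> ?V" for u
    using that by (auto simp: A_def B_def coulomb_sobolev_def)
  have V: "subspace ?V" by (rule subspace_coulomb_sobolev[OF assms])
  have "uniformly_convex ?V (\<lambda>u. sqrt (A u + B u powr (2 / (2 * p))))"
  proof (rule uniformly_convex_sqrt_add[OF V])
    show "0 < 2 * p" using assms by simp
  next
    fix u v assume uv: "u \<in> ?V" "v \<in> ?V"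
    then have "ennreal (A (u + v) + A (u - v)) = ennreal (2 * A u + 2 * A v)"
      using dirichlet_energy_parallelogram[of u v] nonneg V
      by (simp add: fin[symmetric] subspace_add subspace_diff ennreal_mult)
        (simp add: coulomb_sobolev_def)
    then show "A (u + v) + A (u - v) = 2 * A u + 2 * A v"
      using nonneg by (subst (asm) ennreal_inj) auto
  next
    fix u c
    show "B (c *\<^sub>R u) = \<bar>c\<bar> powr (2 * p) * B u"
      by (simp add: B_def coulomb_energy_scaleR[OF assms(1,2)] enn2real_mult)
  next
    fix u v and t :: real assume uv: "u \<in> ?V" "v \<in> ?V" and t: "0 < t" "t < 1"
    then have "t *\<^sub>R u + (1 - t) *\<^sub>R v \<in> ?V" using V by (intro subspace_add subspace_scale)
    then have "ennreal (B (t *\<^sub>R u + (1 - t) *\<^sub>R v)) \<le> ennreal (t * B u + (1 - t) * B v)"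
      using coulomb_energy_convex[OF assms t, of u v] uv t nonneg by (simp add: fin ennreal_mult)
    then show "B (t *\<^sub>R u + (1 - t) *\<^sub>R v) \<le> t * B u + (1 - t) * B v"
      using nonneg t by (subst (asm) ennreal_le_iff) auto
  next
    fix \<eta> :: real assume "0 < \<eta>"
    obtain C where C: "0 \<le> C"
      "\<And>u v :: 'n ae_fun. coulomb_energy \<alpha> p (u - v) + ennreal C * coulomb_energy \<alpha> p ((1 / 2) *\<^sub>R (u + v))
        \<le> ennreal (\<eta> + C / 2) * (coulomb_energy \<alpha> p u + coulomb_energy \<alpha> p v)"
      using coulomb_energy_uniformly_convex[OF assms \<open>0 < \<eta>\<close>] by blast
    have "B (u - v) + C * B ((1 / 2) *\<^sub>R (u + v)) \<le> (\<eta> + C / 2) * (B u + B v)"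
      if uv: "u \<in> ?V" "v \<in> ?V" for u v
    proof -
      have "u - v \<in> ?V" "(1 / 2) *\<^sub>R (u + v) \<in> ?V"
        using uv V by (intro subspace_diff subspace_scale subspace_add; simp)+
      then have "ennreal (B (u - v) + C * B ((1 / 2) *\<^sub>R (u + v))) \<le> ennreal ((\<eta> + C / 2) * (B u + B v))"
        using C(2)[of u v] C(1) uv nonneg \<open>0 < \<eta>\<close> by (simp only: fin) (simp add: ennreal_mult)
      then show ?thesis
        using nonneg C(1) \<open>0 < \<eta>\<close> by (subst (asm) ennreal_le_iff) auto
    qed
    with C(1) show "\<exists>C\<ge>0. \<forall>u\<in>?V. \<forall>v\<in>?V.
        B (u - v) + C * B ((1 / 2) *\<^sub>R (u + v)) \<le> (\<eta> + C / 2) * (B u + B v)" by blast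
  qed (use nonneg in auto)
  then show ?thesis by (simp add: coulomb_sobolev_norm_def[abs_def] A_def B_def)
qed

end
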